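(* For every integer $k\geq 3$ there are positive constants $d_{k\text{-col.}}$ and $\varepsilon_{k\text{-col.}}$ such that, in the bounded degree model with degree bound $d_{k\text{-col.}}$ and proximity parameter $\varepsilon_{k\text{-col.}}$, the query complexity of testing $k$-colorability of $k$-uniform $n$-vertex hypergraphs is $\Omega(n)$; that is, any tester distinguishing $k$-uniform $n$-vertex hypergraphs of maximum degree at most $d_{k\text{-col.}}$ that are $k$-colorable from those that are $\varepsilon_{k\text{-col.}}$-far from being $k$-colorable must make $\Omega(n)$ queries.
   Context: A hypergraph $H$ on vertex set $[n]$ is $k$-uniform if every hyperedge has exactly $k$ vertices; the degree of a vertex is the number of hyperedges containing it. Bounded degree model: for a fixed degree bound $\Delta$, a hypergraph of maximum degree at most $\Delta$ is given by oracle access to lists $A_1,\dots,A_n$, where $A_i$ has length $\Delta$ and contains the hyperedges incident to vertex $i$ (in a fixed global order) padded with dummy symbols $\bot$; a query asks for the $j$-th entry of $A_i$. The distance between two such hypergraphs $H_1=([n],E_1)$, $H_2=([n],E_2)$ is $(|E_1\setminus E_2|+|E_2\setminus E_1|)/(\Delta n)$; $H$ is $\varepsilon$-far from a property $\mathcal P$ if its distance to every $k$-uniform $n$-vertex hypergraph with $\mathcal P$ exceeds $\varepsilon$. An $\varepsilon$-tester for $\mathcal P$ is a randomized oracle machine that, given $n,\varepsilon$ and oracle access to $H$, accepts with probability at least $2/3$ if $H$ has $\mathcal P$ and with probability at most $1/3$ if $H$ is $\varepsilon$-far from $\mathcal P$. Its query complexity is the worst-case number of queries. A hypergraph is $\lambda$-colorable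 if there is a map $V(H)\to\{1,\dots,\lambda\}$ such that every hyperedge contains two vertices of different colors. *)

theory Defs
  imports
    "HOL-Probability.Probability"
    "HOL-Library.Landau_Symbols"
begin

text \<open>
  A hypergraph on the vertex set \<open>{1..n}\<close> is given by the number \<open>n\<close> and its set of
  hyperedges. A property of hypergraphs is a predicate on such pairs.
\<close>

definition all_edges :: "nat \<Rightarrow> nat \<Rightarrow> nat set set" where
  "all_edges k n = {e. e \<subseteq> {1..n} \<and> card e = k}"

definition uniform_hypergraph :: "nat \<Rightarrow> nat \<Rightarrow> nat set set \<Rightarrow> bool" where
  "uniform_hypergraph k n E \<longleftrightarrow> E \<subseteq> all_edges k n"

definition incident_edges :: "nat set set \<Rightarrow> nat \<Rightarrow> nat set set" where
  "incident_edges E v = {e \<in> E. v \<in> e}"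

definition max_degree_le :: "nat \<Rightarrow> nat \<Rightarrow> nat set set \<Rightarrow> bool" where
  "max_degree_le \<Delta> n E \<longleftrightarrow> (\<forall>v\<in>{1..n}. card (incident_edges E v) \<le> \<Delta>)"

definition bounded_hypergraph :: "nat \<Rightarrow> nat \<Rightarrow> nat \<Rightarrow> nat set set \<Rightarrow> bool" where
  "bounded_hypergraph k \<Delta> n E \<longleftrightarrow> uniform_hypergraph k n E \<and> max_degree_le \<Delta> n E"

definition colorable :: "nat \<Rightarrow> nat \<Rightarrow> nat set set \<Rightarrow> bool" where
  "colorable l n E \<longleftrightarrow>
     (\<exists>f \<in> {1..n} \<rightarrow> {1..l}. \<forall>e\<in>E. \<exists>u\<in>e. \<exists>v\<in>e. f u \<noteq> f v)"

definition hypergraph_dist :: "nat \<Rightarrow> nat \<Rightarrow> nat set set \<Rightarrow> nat set set \<Rightarrow> real" where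
  "hypergraph_dist \<Delta> n E\<^sub>1 E\<^sub>2 =
     real (card (E\<^sub>1 - E\<^sub>2) + card (E\<^sub>2 - E\<^sub>1)) / (real \<Delta> * real n)"

definition far_from ::
    "nat \<Rightarrow> nat \<Rightarrow> real \<Rightarrow> (nat \<Rightarrow> nat set set \<Rightarrow> bool) \<Rightarrow> nat \<Rightarrow> nat set set \<Rightarrow> bool" where
  "far_from k \<Delta> \<epsilon> P n E \<longleftrightarrow>
     (\<forall>E'. uniform_hypergraph k n E' \<and> P n E' \<longrightarrow> hypergraph_dist \<Delta> n E E' > \<epsilon>)"

text \<open>
  The relation \<open>r\<close> is the global (reflexive) linear order on the potential hyperedges;
  the list of the hyperedges incident to \<open>v\<close> in this order is unique, see below.
\<close>

definition incidence_list :: "nat set rel \<Rightarrow> nat set set \<Rightarrow> nat \<Rightarrow> nat set list" where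
  "incidence_list r E v =
     (THE xs. set xs = incident_edges E v \<and> distinct xs \<and> sorted_wrt (\<lambda>e f. (e, f) \<in> r) xs)"

lemma ex1_sorted_list:
  assumes "finite A" and "A \<subseteq> B" and "linear_order_on B r"
  shows "\<exists>!xs. set xs = A \<and> distinct xs \<and> sorted_wrt (\<lambda>e f. (e, f) \<in> r) xs"
  using assms(1,2)
proof (induction "card A" arbitrary: A)
  case 0
  then show ?case by auto
next
  case (Suc m)
  have refl: "(x, x) \<in> r" if "x \<in> B" for x
    using assms(3) that by (auto simp: order_on_defs refl_on_def)
  have tr: "(x, z) \<in> r" if "(x, y) \<in> r" "(y, z) \<in> r" for x y z
    using assms(3) that unfolding order_on_defs by (meson transD)
  have anti: "x = y" if "(x, y) \<in> r" "(y, x) \<in> r" for x y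
    using assms(3) that unfolding order_on_defs by (meson antisymD)
  have total: "(x, y) \<in> r \<or> (y, x) \<in> r" if "x \<in> B" "y \<in> B" for x y
    using assms(3) that refl[of x] unfolding linear_order_on_def total_on_def by (cases "x = y") auto
  have least: "\<exists>a\<in>C. \<forall>x\<in>C. (a, x) \<in> r" if "finite C" "C \<noteq> {}" "C \<subseteq> B" for C
    using that
  proof (induction C rule: finite_ne_induct)
    case (singleton x)
    then show ?case using refl by auto
  next
    case (insert x F)
    then obtain a where a: "a \<in> F" "\<forall>y\<in>F. (a, y) \<in> r" by auto
    show ?case
    proof (cases "(a, x) \<in> r")
      case True
      then show ?thesis using a by auto
    next
      case False
      then have xa: "(x, a) \<in> r" using total[of a x] insert.prems a(1) by auto
      moreover have "(x, x) \<in> r" using refl insert.prems by auto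
      ultimately have "\<forall>y\<in>insert x F. (x, y) \<in> r"
        using a(2) tr[OF xa] by blast
      then show ?thesis by blast
    qed
  qed
  have "A \<noteq> {}" using Suc.hyps(2) by auto
  from least[OF Suc.prems(1) this Suc.prems(2)]
  obtain a where a: "a \<in> A" "\<And>x. x \<in> A \<Longrightarrow> (a, x) \<in> r"
    by auto
  have "m = card (A - {a})" using Suc.hyps(2) Suc.prems a(1) by simp
  then have "\<exists>!xs. set xs = A - {a} \<and> distinct xs \<and> sorted_wrt (\<lambda>e f. (e, f) \<in> r) xs"
    using Suc.prems by (intro Suc.hyps(1)) auto
  then obtain xs
    where xs: "set xs = A - {a}" "distinct xs" "sorted_wrt (\<lambda>e f. (e, f) \<in> r) xs"
      and uniq: "\<And>ys. set ys = A - {a} \<and> distinct ys \<and> sorted_wrt (\<lambda>e f. (e, f) \<in> r) ys \<Longrightarrow> ys = xs"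
    by (elim ex1E) blast
  show ?case
  proof (rule ex1I[of _ "a # xs"])
    show "set (a # xs) = A \<and> distinct (a # xs) \<and> sorted_wrt (\<lambda>e f. (e, f) \<in> r) (a # xs)"
      using xs a by auto
  next
    fix ys assume ys: "set ys = A \<and> distinct ys \<and> sorted_wrt (\<lambda>e f. (e, f) \<in> r) ys"
    then obtain b zs where bz: "ys = b # zs" using a(1) by (cases ys) auto
    have "b = a"
    proof (rule ccontr)
      assume "b \<noteq> a"
      then have "a \<in> set zs" using ys bz a(1) by auto
      then have "(b, a) \<in> r" using ys bz by auto
      moreover have "(a, b) \<in> r" using ys bz a(2) by auto
      ultimately show False using anti \<open>b \<noteq> a\<close> by blast
    qed
    moreover have "zs = xs" using uniq[of zs] ys bz \<open>b = a\<close> by auto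
    ultimately show "ys = a # xs" using bz by simp
  qed
qed

text \<open>
  The answer to a query \<open>(v, j)\<close>, with \<open>j\<close> counted from 1. The dummy symbol is
  \<^const>\<open>None\<close>, which is also returned for indices out of range.
\<close>

definition padded_list :: "nat \<Rightarrow> nat set rel \<Rightarrow> nat set set \<Rightarrow> nat \<Rightarrow> nat set option list" where
  "padded_list \<Delta> r E v =
     (let xs = incidence_list r E v in map Some xs @ replicate (\<Delta> - length xs) None)"

definition incidence_oracle ::
    "nat \<Rightarrow> nat set rel \<Rightarrow> nat \<Rightarrow> nat set set \<Rightarrow> nat \<Rightarrow> nat \<Rightarrow> nat set option" where
  "incidence_oracle \<Delta> r n E v j =
     (if v \<in> {1..n} \<and> j \<in> {1..\<Delta>} then padded_list \<Delta> r E v ! (j - 1) else None)"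

text \<open>
  A deterministic oracle algorithm for a fixed input size is an adaptive decision tree; a
  randomized one is a probability distribution over such trees (all random choices are made
  in advance).
\<close>

datatype query_tree =
    Answer bool
  | Query nat nat "nat set option \<Rightarrow> query_tree"

primrec accepts :: "(nat \<Rightarrow> nat \<Rightarrow> nat set option) \<Rightarrow> query_tree \<Rightarrow> bool" where
  "accepts orc (Answer b) = b"
| "accepts orc (Query v j next) = accepts orc (next (orc v j))"

primrec num_queries :: "(nat \<Rightarrow> nat \<Rightarrow> nat set option) \<Rightarrow> query_tree \<Rightarrow> nat" where
  "num_queries orc (Answer b) = 0"
| "num_queries orc (Query v j next) = Suc (num_queries orc (next (orc v j)))"

definition accept_prob :: "(nat \<Rightarrow> nat \<Rightarrow> nat set option) \<Rightarrow> query_tree pmf \<Rightarrow> real" where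
  "accept_prob orc T = measure_pmf.prob T {t. accepts orc t}"

definition is_tester ::
    "nat \<Rightarrow> nat \<Rightarrow> real \<Rightarrow> (nat \<Rightarrow> nat set set \<Rightarrow> bool) \<Rightarrow> nat set rel \<Rightarrow> nat \<Rightarrow> query_tree pmf \<Rightarrow> bool"
where
  "is_tester k \<Delta> \<epsilon> P r n T \<longleftrightarrow>
     (\<forall>E. bounded_hypergraph k \<Delta> n E \<longrightarrow>
        (P n E \<longrightarrow> accept_prob (incidence_oracle \<Delta> r n E) T \<ge> 2 / 3) \<and>
        (far_from k \<Delta> \<epsilon> P n E \<longrightarrow> accept_prob (incidence_oracle \<Delta> r n E) T \<le> 1 / 3))"

definition queries_at_most ::
    "nat \<Rightarrow> nat \<Rightarrow> nat set rel \<Rightarrow> nat \<Rightarrow> query_tree pmf \<Rightarrow> nat \<Rightarrow> bool" where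
  "queries_at_most k \<Delta> r n T q \<longleftrightarrow>
     (\<forall>E. bounded_hypergraph k \<Delta> n E \<longrightarrow>
        (\<forall>t\<in>set_pmf T. num_queries (incidence_oracle \<Delta> r n E) t \<le> q))"

text \<open>
  The least worst-case number of queries of a tester for \<open>n\<close>-vertex hypergraphs; \<open>r n\<close>
  is the order on the potential hyperedges on \<open>{1..n}\<close>. If there were no tester, the infimum
  would be 0, so lower bounds on it never hold vacuously.
\<close>

definition testing_query_complexity ::
    "nat \<Rightarrow> nat \<Rightarrow> real \<Rightarrow> (nat \<Rightarrow> nat set set \<Rightarrow> bool) \<Rightarrow> (nat \<Rightarrow> nat set rel) \<Rightarrow> nat \<Rightarrow> nat" where
  "testing_query_complexity k \<Delta> \<epsilon> P r n =
     Inf {q. \<exists>T. is_tester k \<Delta> \<epsilon> P (r n) n T \<and> queries_at_most k \<Delta> (r n) n T q}"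

end

theory Submission
  imports Defs "HOL-Number_Theory.Cong"
begin

text \<open>
  Let \<open>B\<close> be a sparse random \<open>k\<close>-uniform hypergraph on \<open>m = n div k\<close> vertices: it has bounded
  degree, every set of at most \<open>\<delta> m\<close> hyperedges has a vertex lying in exactly one of them, and
  every set of at least \<open>m / k\<close> vertices contains \<open>m\<close> hyperedges. Given labels \<open>a\<^sub>e\<close>, lift \<open>B\<close> to
  \<open>\<int>\<^sub>k\<close>-copies of its vertices, replacing \<open>e\<close> by all \<open>{(x, s\<^sub>x) | x \<in> e}\<close> with
  \<open>\<Sum> s\<^sub>x = a\<^sub>e\<close> in \<open>\<int>\<^sub>k\<close>. For any vertex labelling \<open>g\<close>:

  \<^item> if \<open>a\<^sub>e = 1 + \<Sum>\<^bsub>x\<in>e\<^esub> g x\<close>, colouring \<open>(x, s)\<close> by \<open>s - g x\<close> makes the colours of each hyperedge sum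
    to 1, whereas \<open>k\<close> equal colours sum to 0; so the lift is \<open>k\<close>-colorable;
  \<^item> if \<open>a\<^sub>e = \<Sum>\<^bsub>x\<in>e\<^esub> g x\<close>, the vertices \<open>(x, g x)\<close> span a copy of \<open>B\<close>, and the most frequent colour
    on it has \<open>m\<close> monochromatic hyperedges; so the lift is far from \<open>k\<close>-colorable.

  A run with few queries sees few labels. The unique neighbours yield an integral solution \<open>h\<close> of
  \<open>\<Sum>\<^bsub>x\<in>e\<^esub> h x = 1\<close> for the hyperedges seen, so \<open>g \<mapsto> g + h\<close> carries runs on the first kind of input
  injectively to identical runs on the second kind. Hence a tester with few queries accepts a random
  input of the second kind at least as often as one of the first.
\<close>

section \<open>Sparse expanding hypergraphs\<close>

text \<open>Give each subset S the weight \<open>q ^ card S\<close> with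
  \<open>q = y / card A\<close>, which is at most 1. Each counted set weighs at least
  \<open>q powr y\<close>, while all subsets together weigh \<open>(1 + q) ^ card A\<close>, at most
  \<open>exp y\<close>.\<close>

lemma card_small_subsets_le:
  fixes y :: real
  assumes "finite A" "0 < y" "y \<le> card A"
  shows "card {S. S \<subseteq> A \<and> card S \<le> y} \<le> (exp 1 * card A / y) powr y"
proof -
  define q where "q = y / card A"
  have n: "real (card A) > 0" using assms by linarith
  have q: "0 < q" "q \<le> 1" using assms n by (auto simp: q_def field_simps)
  let ?X = "{S. S \<subseteq> A \<and> card S \<le> y}"
  have fin: "finite ?X" using assms(1) by auto
  have "card ?X * q powr y = (\<Sum>S\<in>?X. q powr y)" by simp
  also have "\<dots> \<le> (\<Sum>S\<in>?X. q ^ card S)"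
    using q by (intro sum_mono) (auto simp: powr_realpow[symmetric] intro!: powr_mono')
  also have "\<dots> \<le> (\<Sum>S\<in>Pow A. q ^ card S)"
    using assms(1) q by (intro sum_mono2) auto
  also have "\<dots> = (1 + q) ^ card A"
    using prod_add[OF assms(1), of "\<lambda>_. q" "\<lambda>_. 1"] by (simp add: add.commute)
  also have "\<dots> \<le> exp q ^ card A"
    using q by (intro power_mono) (auto simp: exp_ge_add_one_self)
  also have "\<dots> = exp 1 powr y"
    using n by (simp add: exp_of_nat_mult[symmetric] q_def powr_def)
  finally have "card ?X \<le> exp 1 powr y / q powr y"
    using q by (simp add: field_simps)
  also have "\<dots> = (exp 1 / q) powr y"
    using q by (simp add: powr_divide)
  finally show ?thesis by (simp add: q_def)
qed

text \<open>Passing from k to k + 1 multiplies the ratio of the binomials by (v - k) / (m - k),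
  which is at most v / m. Fractions are cleared to stay in the naturals, where truncated subtraction
  makes the case k > v trivial.\<close>

lemma binomial_ratio_le:
  fixes v m k :: nat
  assumes "v \<le> m"
  shows "(v choose k) * m ^ k \<le> (m choose k) * v ^ k"
proof (induction k)
  case (Suc k)
  have *: "(v - k) * m \<le> v * (m - k)"
  proof (cases "k \<le> v")
    case True
    have "int (v - k) * int m \<le> int v * int (m - k)"
      using assms True by (simp add: of_nat_diff algebra_simps mult_left_mono)
    then show ?thesis by (metis of_nat_le_iff of_nat_mult)
  qed simp
  have absorb: "Suc k * (n choose Suc k) = (n - k) * (n choose k)" for n
    by (metis binomial_absorb_comp binomial_absorption mult.commute)
  have "Suc k * ((v choose Suc k) * m ^ Suc k) = (Suc k * (v choose Suc k)) * m * m ^ k"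
    by (simp only: power_Suc mult_ac)
  also have "\<dots> = ((v - k) * m) * ((v choose k) * m ^ k)"
    by (simp only: absorb mult_ac)
  also have "\<dots> \<le> (v * (m - k)) * ((m choose k) * v ^ k)"
    by (intro mult_mono * Suc.IH) auto
  also have "\<dots> = ((m - k) * (m choose k)) * v * v ^ k"
    by (simp only: mult_ac)
  also have "\<dots> = (Suc k * (m choose Suc k)) * v * v ^ k"
    by (simp only: absorb)
  also have "\<dots> = Suc k * ((m choose Suc k) * v ^ Suc k)"
    by (simp only: power_Suc mult_ac)
  finally show ?case
    by (simp only: mult_le_cancel1)
qed simp

text \<open>Double counting: were every vertex of the union in two members of the family, there
  would be at least twice as many incidences as vertices, yet there are only
  \<open>k * card F\<close>. Hyperedges are indexed by positions, so repetitions count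
  separately.\<close>

lemma unique_neighbour_if_expanding:
  assumes "finite F" "\<And>t. t \<in> F \<Longrightarrow> finite (\<omega> t) \<and> card (\<omega> t) = k"
    and "k * card F < 2 * card (\<Union>t\<in>F. \<omega> t)"
  shows "\<exists>t\<in>F. \<exists>x\<in>\<omega> t. \<forall>t'\<in>F. x \<in> \<omega> t' \<longrightarrow> t' = t"
proof (rule ccontr)
  assume neg: "\<not> ?thesis"
  let ?U = "\<Union>t\<in>F. \<omega> t"
  have fU: "finite ?U" using assms by auto
  have two: "2 \<le> card {t \<in> F. x \<in> \<omega> t}" if x: "x \<in> ?U" for x
  proof -
    obtain t where t: "t \<in> F" "x \<in> \<omega> t" using x by auto
    obtain t' where t': "t' \<in> F" "x \<in> \<omega> t'" "t' \<noteq> t" using neg t by blast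
    have "card {t, t'} \<le> card {t \<in> F. x \<in> \<omega> t}"
      using assms(1) t t' by (intro card_mono) auto
    then show ?thesis using t' by simp
  qed
  have "2 * card ?U = (\<Sum>x\<in>?U. 2)" by simp
  also have "\<dots> \<le> (\<Sum>x\<in>?U. card {t \<in> F. x \<in> \<omega> t})"
    using two by (rule sum_mono)
  also have "\<dots> = (\<Sum>t\<in>F. k)"
  proof (rule sum_multicount_gen[OF fU assms(1)], intro ballI)
    fix t assume "t \<in> F"
    then have "{x \<in> ?U. x \<in> \<omega> t} = \<omega> t" by auto
    then show "card {x \<in> ?U. x \<in> \<omega> t} = k" using assms(2) \<open>t \<in> F\<close> by simp
  qed
  finally show False using assms(3) by (simp add: mult.commute)
qed

text \<open>Every hit carries weight 1/2, so a sequence with fewer than m hits weighs at least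
  \<open>(1 / 2) ^ m\<close>. The total weight of all sequences factorises over the T positions,
  each contributing \<open>card K\<close> minus half the number of elements satisfying P.\<close>

lemma card_few_hits_le:
  fixes K :: "'a set" and T m :: nat
  assumes "finite K"
  shows "card {\<omega> \<in> {..<T} \<rightarrow>\<^sub>E K. card {t \<in> {..<T}. P (\<omega> t)} < m}
    \<le> 2 ^ m * (card K - card {e \<in> K. P e} / 2) ^ T"
proof -
  let ?\<Omega> = "{..<T} \<rightarrow>\<^sub>E K"
  let ?w = "\<lambda>e. if P e then 1 / 2 else 1 :: real"
  have fin: "finite ?\<Omega>" using assms by (intro finite_PiE) auto
  have prod: "(\<Prod>t<T. ?w (\<omega> t)) = (1 / 2) ^ card {t \<in> {..<T}. P (\<omega> t)}" for \<omega> :: "nat \<Rightarrow> 'a"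
    by (subst prod.If_cases) (auto simp: Int_def)
  let ?bad = "{\<omega> \<in> ?\<Omega>. card {t \<in> {..<T}. P (\<omega> t)} < m}"
  have "real (card ?bad) = (\<Sum>\<omega>\<in>?bad. 1)" by simp
  also have "\<dots> \<le> (\<Sum>\<omega>\<in>?bad. 2 ^ m * (\<Prod>t<T. ?w (\<omega> t)))"
  proof (rule sum_mono)
    fix \<omega> assume "\<omega> \<in> ?bad"
    then have "card {t \<in> {..<T}. P (\<omega> t)} \<le> m" by simp
    then have "(1 / 2 :: real) ^ m \<le> (1 / 2) ^ card {t \<in> {..<T}. P (\<omega> t)}"
      by (intro power_decreasing) auto
    then have "2 ^ m * (1 / 2 :: real) ^ m \<le> 2 ^ m * (\<Prod>t<T. ?w (\<omega> t))"
      unfolding prod by (intro mult_left_mono) auto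
    then show "1 \<le> 2 ^ m * (\<Prod>t<T. ?w (\<omega> t))"
      by (simp flip: power_mult_distrib)
  qed
  also have "\<dots> \<le> (\<Sum>\<omega>\<in>?\<Omega>. 2 ^ m * (\<Prod>t<T. ?w (\<omega> t)))"
  proof (rule sum_mono2[OF fin])
    show "?bad \<subseteq> ?\<Omega>" by blast
    show "0 \<le> 2 ^ m * (\<Prod>t<T. ?w (\<omega> t))" for \<omega>
      by (intro mult_nonneg_nonneg prod_nonneg) auto
  qed
  also have "\<dots> = 2 ^ m * (\<Prod>t<T. \<Sum>e\<in>K. ?w e)"
    unfolding sum_distrib_left[symmetric] by (subst prod_sum_PiE) (simp_all add: assms)
  also have "(\<Sum>e\<in>K. ?w e) = (\<Sum>e\<in>K. 1 - (if P e then 1 / 2 else 0))"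
    by (intro sum.cong) auto
  also have "\<dots> = card K - card {e \<in> K. P e} / 2"
    using assms by (simp add: sum_subtractf sum.If_cases Int_def)
  finally show ?thesis by simp
qed

text \<open>The factors form the union bound for s hyperedges inside few vertices: choices of s
  positions, choices of at most \<open>k * s / 2\<close> vertices, and the chance that all s
  hyperedges fall there. Per hyperedge the product is at most a constant times
  \<open>sqrt (s / m)\<close>, because k \<ge> 3 leaves an exponent 3/2 against the single 1/r of
  the first factor.\<close>

lemma nonexpanding_term_le:
  fixes k m C s :: nat and \<delta> :: real
  assumes "k \<ge> 3" "s \<ge> 1" "m \<ge> 1" "real s \<le> \<delta> * m"
    and "exp 1 * k * \<delta> \<le> 2"
    and "exp 1 * C * (exp 1 * k / 2) powr (3 / 2) * sqrt \<delta> \<le> 1 / 4"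
  shows "(exp 1 * real (C * m) / s) powr s * ((exp 1 * real m / (k * s / 2)) powr (k * s / 2)
    * (k * s / 2 / m) ^ (k * s)) \<le> (1 / 4) ^ s"
proof -
  \<comment> \<open>\<open>r\<close> is the number of hyperedges and \<open>z\<close> the largest
    admissible number of vertices, both relative to m.\<close>
  define r where "r = s / m"
  define z where "z = k * r / 2"
  have r: "r > 0" "r \<le> \<delta>" using assms by (auto simp: r_def field_simps)
  have z: "z > 0" using r assms by (simp add: z_def)
  have ez: "exp 1 * z \<le> 1"
  proof -
    have "exp 1 * k * r \<le> exp 1 * k * \<delta>" using r by (intro mult_left_mono) auto
    moreover have "exp 1 * z = exp 1 * k * r / 2" by (simp add: z_def)
    ultimately show ?thesis using assms(5) by linarith
  qed
  have e1: "exp 1 * real (C * m) / s = exp 1 * C / r"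
    using assms by (simp add: r_def)
  have e2: "exp 1 * real m / (k * s / 2) = exp 1 / z" and e3: "k * s / 2 / m = z"
    using assms by (simp_all add: r_def z_def)
  have "(exp 1 / z) powr (k * s / 2) * z ^ (k * s) = (exp 1 * z) powr (k * s / 2)"
  proof -
    have "z ^ (k * s) = z powr (k * s / 2 + k * s / 2)"
      using z by (simp add: powr_realpow[symmetric])
    also have "\<dots> = z powr (k * s / 2) * z powr (k * s / 2)" by (simp only: powr_add)
    finally show ?thesis using z by (simp add: powr_divide powr_mult)
  qed
  also have "\<dots> = ((exp 1 * z) powr (k / 2)) powr s"
    by (simp add: powr_powr)
  \<comment> \<open>As \<open>exp 1 * z\<close> is at most 1, lowering the exponent from k / 2 to 3
    / 2 can only enlarge the power.\<close>
  also have "\<dots> \<le> ((exp 1 * z) powr (3 / 2)) powr s"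
    using assms z ez by (intro powr_mono2 powr_mono') auto
  finally have "(exp 1 * real (C * m) / s) powr s * ((exp 1 * real m / (k * s / 2)) powr (k * s / 2)
    * (k * s / 2 / m) ^ (k * s)) \<le> (exp 1 * C / r) powr s * ((exp 1 * z) powr (3 / 2)) powr s"
    unfolding e1 e2 e3 by (intro mult_left_mono) auto
  also have "\<dots> = (exp 1 * C / r * (exp 1 * z) powr (3 / 2)) powr s"
    by (simp only: powr_mult)
  also have "exp 1 * C / r * (exp 1 * z) powr (3 / 2) = exp 1 * C * (exp 1 * k / 2) powr (3 / 2) * sqrt r"
  proof -
    have "(exp 1 * z) powr (3 / 2) = (exp 1 * k / 2 * r) powr (3 / 2)" by (simp add: z_def mult.assoc)
    also have "\<dots> = (exp 1 * k / 2) powr (3 / 2) * r powr (1 + 1 / 2)"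
      using r by (subst powr_mult) auto
    also have "r powr (1 + 1 / 2) = r * sqrt r"
      using r by (subst powr_add) (simp add: powr_half_sqrt)
    finally show ?thesis using r by simp
  qed
  also have "(exp 1 * C * (exp 1 * k / 2) powr (3 / 2) * sqrt r) powr s \<le> (1 / 4) powr s"
  proof (rule powr_mono2)
    have "exp 1 * C * (exp 1 * k / 2) powr (3 / 2) * sqrt r
        \<le> exp 1 * C * (exp 1 * k / 2) powr (3 / 2) * sqrt \<delta>"
      using r by (intro mult_left_mono) auto
    then show "exp 1 * C * (exp 1 * k / 2) powr (3 / 2) * sqrt r \<le> 1 / 4" using assms(6) by linarith
  qed (use r in auto)
  also have "\<dots> = (1 / 4) ^ s" by (simp add: powr_realpow)
  finally show ?thesis .
qed

section \<open>First-moment bounds for random sequences of hyperedges\<close>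

text \<open>Union bound over the size s of F, then F, then a set S of at most
  \<open>k * s / 2\<close> vertices containing the hyperedges indexed by F; in a bad sequence their
  union serves as S. The layers contribute at most 1/4 + 1/16 + ... = 1/3 of all sequences.\<close>

lemma card_nonexpanding_le:
  fixes k m C :: nat and \<delta> :: real
  assumes "k \<ge> 3" "m \<ge> 1" "C \<ge> 1"
    and \<delta>: "exp 1 * k * \<delta> \<le> 2"
    and "exp 1 * C * (exp 1 * k / 2) powr (3 / 2) * sqrt \<delta> \<le> 1 / 4"
  defines "K \<equiv> {e. e \<subseteq> {..<m} \<and> card e = k}"
  shows "card {\<omega> \<in> {..<C * m} \<rightarrow>\<^sub>E K. \<exists>F\<subseteq>{..<C * m}. F \<noteq> {} \<and> card F \<le> \<delta> * m \<and>
    2 * card (\<Union>t\<in>F. \<omega> t) \<le> k * card F} \<le> real (card K) ^ (C * m) / 3"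
proof -
  define T where "T = C * m"
  define \<Omega> where "\<Omega> = {..<T} \<rightarrow>\<^sub>E K"
  define N where "N = real (card K)"
  let ?\<F> = "\<lambda>s. {F. F \<subseteq> {..<T} \<and> card F = s}"
  let ?\<S> = "\<lambda>s. {S. S \<subseteq> {..<m} \<and> card S \<le> real (k * s) / 2}"
  let ?in = "\<lambda>F S. {\<omega> \<in> \<Omega>. \<forall>t\<in>F. \<omega> t \<subseteq> S}"
  let ?I = "{1..nat \<lfloor>\<delta> * m\<rfloor>}"
  have finK: "finite K" by (rule finite_subset[of _ "Pow {..<m}"]) (auto simp: K_def)
  have fin\<Omega>: "finite \<Omega>" using finK by (auto simp: \<Omega>_def intro!: finite_PiE)
  have cK: "card K = m choose k" unfolding K_def using n_subsets[of "{..<m}" k] by simp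
  have finF: "finite (?\<F> s)" and finS: "finite (?\<S> s)" for s by auto
  have I: "s \<ge> 1" "real s \<le> \<delta> * m" if "s \<in> ?I" for s
    using that by (simp, simp, linarith)
  \<comment> \<open>A random hyperedge lies in S with probability at most
    \<open>(card S / m) ^ k\<close>, independently at the s positions of F.\<close>
  have card_in: "card (?in F S) \<le> N ^ T * (k * s / 2 / m) ^ (k * s)"
    if F: "F \<in> ?\<F> s" and S: "S \<in> ?\<S> s" for s F S
  proof -
    have FT: "F \<subseteq> {..<T}" "card F = s" and Sm: "S \<subseteq> {..<m}" "real (card S) \<le> real (k * s) / 2"
      using F S by auto
    have finFF: "finite F" using finite_subset[OF FT(1)] by simp
    define KS where "KS = {e \<in> K. e \<subseteq> S}"
    have "KS = {e. e \<subseteq> S \<and> card e = k}" using Sm(1) by (auto simp: K_def KS_def)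
    then have cKS: "card KS = card S choose k"
      using n_subsets[of S k] finite_subset[OF Sm(1)] by simp
    have "card S \<le> m" using Sm card_mono[of "{..<m}" S] by simp
    then have "real (card KS * m ^ k) \<le> real (card K * card S ^ k)"
      unfolding cKS cK by (intro of_nat_mono binomial_ratio_le)
    then have "card KS \<le> N * (card S / m) ^ k"
      using assms(2) by (simp add: N_def field_simps)
    also have "\<dots> \<le> N * (k * s / 2 / m) ^ k"
      using Sm(2) by (intro mult_left_mono power_mono divide_right_mono) (auto simp: N_def)
    finally have KS: "card KS \<le> N * (k * s / 2 / m) ^ k" .
    have "(\<forall>t\<in>{..<T}. \<omega> t \<in> (if t \<in> F then KS else K)) \<longleftrightarrow>
        (\<forall>t\<in>{..<T}. \<omega> t \<in> K) \<and> (\<forall>t\<in>F. \<omega> t \<subseteq> S)" for \<omega>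
    proof
      assume *: "\<forall>t\<in>{..<T}. \<omega> t \<in> (if t \<in> F then KS else K)"
      have "\<omega> t \<in> KS" if "t \<in> F" for t using *[THEN bspec, of t] FT(1) that by auto
      moreover have "\<omega> t \<in> K" if "t \<in> {..<T}" for t
        using *[THEN bspec, OF that] by (simp add: KS_def split: if_splits)
      ultimately show "(\<forall>t\<in>{..<T}. \<omega> t \<in> K) \<and> (\<forall>t\<in>F. \<omega> t \<subseteq> S)" by (simp add: KS_def)
    qed (simp add: KS_def)
    then have "?in F S = (\<Pi>\<^sub>E t\<in>{..<T}. if t \<in> F then KS else K)"
      unfolding \<Omega>_def set_eq_iff mem_Collect_eq PiE_iff by blast
    then have "card (?in F S) = (\<Prod>t<T. if t \<in> F then card KS else card K)"
      by (simp add: card_PiE if_distrib)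
    also have "\<dots> = card KS ^ s * card K ^ (T - s)"
    proof -
      have "{..<T} \<inter> {t. t \<in> F} = F" "{..<T} \<inter> - {t. t \<in> F} = {..<T} - F" using FT(1) by auto
      moreover have "card ({..<T} - F) = T - s" using FT finFF by (simp add: card_Diff_subset)
      ultimately show ?thesis using FT by (subst prod.If_cases) simp_all
    qed
    finally have "real (card (?in F S)) = real (card KS) ^ s * N ^ (T - s)" by (simp add: N_def)
    also have "\<dots> \<le> (N * (k * s / 2 / m) ^ k) ^ s * N ^ (T - s)"
      using KS by (intro mult_right_mono power_mono) (auto simp: N_def)
    also have "\<dots> = N ^ (s + (T - s)) * (k * s / 2 / m) ^ (k * s)"
      by (simp add: power_mult_distrib power_add power_mult)
    also have "s + (T - s) = T" using FT card_mono[of "{..<T}" F] by simp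
    finally show ?thesis .
  qed
  have layer: "(\<Sum>F\<in>?\<F> s. \<Sum>S\<in>?\<S> s. card (?in F S)) \<le> N ^ T * (1 / 4) ^ s" if "s \<in> ?I" for s
  proof -
    have s: "s \<ge> 1" "real s \<le> \<delta> * m" using I that by auto
    \<comment> \<open>These steps lead to \<open>k * s / 2 \<le> m\<close> and
      \<open>s \<le> T\<close>, the side conditions of \<open>card_small_subsets_le\<close> for
      vertex sets and for sets of positions.\<close>
    have "\<delta> \<ge> 0"
    proof (rule ccontr)
      assume "\<not> \<delta> \<ge> 0"
      then have "\<delta> * m \<le> 0" by (simp add: mult_nonpos_nonneg)
      then show False using s by simp
    qed
    then have "1 * (k * \<delta>) \<le> exp 1 * (k * \<delta>)" by (intro mult_right_mono) auto
    then have "k * \<delta> \<le> 2" using \<delta> by (simp add: mult.assoc)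
    then have "k * \<delta> * m \<le> 2 * real m" by (intro mult_right_mono) auto
    moreover have "real k * s \<le> k * (\<delta> * m)" using s by (intro mult_left_mono) auto
    ultimately have km: "k * s / 2 \<le> m" by simp
    have "3 * real s \<le> real k * s" using assms(1) by (intro mult_right_mono) auto
    then have "s \<le> m" using km by simp
    also have "m \<le> T" using assms(3) by (simp add: T_def)
    finally have sT: "s \<le> T" .
    have "(\<Sum>F\<in>?\<F> s. \<Sum>S\<in>?\<S> s. card (?in F S)) \<le>
      (\<Sum>F\<in>?\<F> s. \<Sum>S\<in>?\<S> s. N ^ T * (k * s / 2 / m) ^ (k * s))"
      using card_in unfolding of_nat_sum by (intro sum_mono) blast
    also have "\<dots> = N ^ T * (card (?\<F> s) * (card (?\<S> s) * (k * s / 2 / m) ^ (k * s)))"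
      by simp
    also have "\<dots> \<le> N ^ T * ((exp 1 * real T / s) powr s *
      ((exp 1 * real m / (k * s / 2)) powr (k * s / 2) * (k * s / 2 / m) ^ (k * s)))"
    proof (intro mult_left_mono mult_mono mult_right_mono)
      have "card (?\<F> s) \<le> card {F. F \<subseteq> {..<T} \<and> real (card F) \<le> s}"
        by (intro card_mono) auto
      also have "real \<dots> \<le> (exp 1 * real T / s) powr s"
        using card_small_subsets_le[of "{..<T}" s] sT I[OF that] by simp
      finally show "card (?\<F> s) \<le> (exp 1 * real T / s) powr s" by simp
      show "card (?\<S> s) \<le> (exp 1 * real m / (k * s / 2)) powr (k * s / 2)"
        using card_small_subsets_le[of "{..<m}" "k * s / 2"] km I[OF that] assms(1) by simp
    qed (auto simp: N_def)
    also have "\<dots> \<le> N ^ T * (1 / 4) ^ s"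
      unfolding T_def using I[OF that] assms
      by (intro mult_left_mono nonexpanding_term_le[of k s m \<delta> C]) (auto simp: N_def)
    finally show ?thesis .
  qed
  let ?bad = "{\<omega> \<in> \<Omega>. \<exists>F\<subseteq>{..<T}. F \<noteq> {} \<and> card F \<le> \<delta> * m \<and> 2 * card (\<Union>t\<in>F. \<omega> t) \<le> k * card F}"
  have "?bad \<subseteq> (\<Union>s\<in>?I. \<Union>F\<in>?\<F> s. \<Union>S\<in>?\<S> s. ?in F S)"
  proof
    fix \<omega> assume "\<omega> \<in> ?bad"
    then obtain F where \<omega>: "\<omega> \<in> \<Omega>" and F: "F \<subseteq> {..<T}" "F \<noteq> {}" "card F \<le> \<delta> * m"
      "2 * card (\<Union>t\<in>F. \<omega> t) \<le> k * card F" by auto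
    have "card F > 0" using F finite_subset by (auto simp: card_gt_0_iff)
    then have "card F \<in> ?I" using F by (auto simp: le_nat_floor)
    moreover have "(\<Union>t\<in>F. \<omega> t) \<in> ?\<S> (card F)"
    proof -
      have "real (2 * card (\<Union>t\<in>F. \<omega> t)) \<le> real (k * card F)" using F by (intro of_nat_mono)
      moreover have "(\<Union>t\<in>F. \<omega> t) \<subseteq> {..<m}" using \<omega> F by (fastforce simp: \<Omega>_def K_def PiE_iff)
      ultimately show ?thesis by auto
    qed
    moreover have "\<omega> \<in> ?in F (\<Union>t\<in>F. \<omega> t)" using \<omega> by auto
    ultimately show "\<omega> \<in> (\<Union>s\<in>?I. \<Union>F\<in>?\<F> s. \<Union>S\<in>?\<S> s. ?in F S)" using F(1) by blast
  qed
  then have "card ?bad \<le> card (\<Union>s\<in>?I. \<Union>F\<in>?\<F> s. \<Union>S\<in>?\<S> s. ?in F S)"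
    using fin\<Omega> by (intro card_mono finite_UN_I finF finS) auto
  also have "\<dots> \<le> (\<Sum>s\<in>?I. \<Sum>F\<in>?\<F> s. \<Sum>S\<in>?\<S> s. card (?in F S))"
    by (intro order.trans[OF card_UN_le] sum_mono finF finS order.refl) auto
  also have "real \<dots> \<le> (\<Sum>s\<in>?I. N ^ T * (1 / 4) ^ s)"
    unfolding of_nat_sum[of _ ?I] using layer by (intro sum_mono)
  also have "\<dots> \<le> N ^ T * (1 / 3)"
  proof -
    have "(\<Sum>s\<in>{1..n}. (1 / 4 :: real) ^ s) = (1 - (1 / 4) ^ n) / 3" for n
      by (induction n) (auto simp: diff_divide_distrib)
    then have "(\<Sum>s\<in>?I. (1 / 4 :: real) ^ s) \<le> 1 / 3" by simp
    then show ?thesis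
      unfolding sum_distrib_left[symmetric] by (intro mult_left_mono) (auto simp: N_def)
  qed
  finally show ?thesis by (simp add: T_def \<Omega>_def N_def)
qed

text \<open>Union bound over the at most \<open>2 ^ m\<close> sets V. Each contains a fraction at
  least p of all hyperedges, so \<open>card_few_hits_le\<close> applies. The threshold m / (2k),
  rather than m / k, leaves room for discarding vertices of high degree later.\<close>

lemma card_sparse_le:
  fixes k m C :: nat
  assumes "k \<ge> 1" "m \<ge> 2 * k * k"
  defines "K \<equiv> {e. e \<subseteq> {..<m} \<and> card e = k}" and "p \<equiv> (1 / (2 * k * k)) ^ k :: real"
  shows "card {\<omega> \<in> {..<C * m} \<rightarrow>\<^sub>E K. \<exists>V\<subseteq>{..<m}. m \<le> 2 * k * card V \<and>
    card {t \<in> {..<C * m}. \<omega> t \<subseteq> V} < m} \<le> real (card K) ^ (C * m) * (4 * (1 - p / 2) ^ C) ^ m"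
proof -
  define T where "T = C * m"
  define N where "N = real (card K)"
  let ?\<V> = "{V. V \<subseteq> {..<m} \<and> m \<le> 2 * k * card V}"
  let ?few = "\<lambda>V. {\<omega> \<in> {..<T} \<rightarrow>\<^sub>E K. card {t \<in> {..<T}. \<omega> t \<subseteq> V} < m}"
  have finK: "finite K" by (rule finite_subset[of _ "Pow {..<m}"]) (auto simp: K_def)
  have fin\<Omega>: "finite ({..<T} \<rightarrow>\<^sub>E K)" using finK by (auto intro!: finite_PiE)
  have "k \<le> 2 * k * k" by simp
  then have km: "k \<le> m" using assms(2) by linarith
  have few: "card (?few V) \<le> 2 ^ m * (N * (1 - p / 2)) ^ T" if "V \<in> ?\<V>" for V
  proof -
    have V: "V \<subseteq> {..<m}" "m \<le> 2 * k * card V" using that by auto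
    have "{e \<in> K. e \<subseteq> V} = {e. e \<subseteq> V \<and> card e = k}" using V by (auto simp: K_def)
    then have cKV: "card {e \<in> K. e \<subseteq> V} = card V choose k"
      using n_subsets[of V k] V finite_subset[of V "{..<m}"] by auto
    have "2 * k * k \<le> 2 * k * card V" using V assms by linarith
    then have "k \<le> card V" using assms(1) by simp
    have "N = real (m choose k)" unfolding N_def K_def using n_subsets[of "{..<m}" k] by simp
    also have "\<dots> \<le> real (m ^ k)" using km by (intro of_nat_mono binomial_le_pow)
    finally have "p * N \<le> p * m ^ k" by (intro mult_left_mono) (auto simp: p_def)
    also have "\<dots> = (m / (2 * k * k)) ^ k" by (simp add: p_def power_divide)
    also have "\<dots> \<le> (card V / k) ^ k"
    proof (rule power_mono)
      have "real m \<le> real (2 * k * card V)" using V by (intro of_nat_mono)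
      then show "m / (2 * k * k) \<le> card V / k" using assms(1) by (simp add: field_simps)
    qed simp
    also have "\<dots> \<le> card V choose k"
      using binomial_ge_n_over_k_pow_k[OF \<open>k \<le> card V\<close>, where ?'a = real] by simp
    finally have KV: "p * N \<le> card {e \<in> K. e \<subseteq> V}" by (simp add: cKV)
    have "card {e \<in> K. e \<subseteq> V} \<le> N"
      unfolding N_def using finK by (intro of_nat_mono card_mono) auto
    have "card (?few V) \<le> 2 ^ m * (N - card {e \<in> K. e \<subseteq> V} / 2) ^ T"
      unfolding N_def by (rule card_few_hits_le[OF finK])
    also have "\<dots> \<le> 2 ^ m * (N * (1 - p / 2)) ^ T"
      using KV \<open>card {e \<in> K. e \<subseteq> V} \<le> N\<close>
      by (intro mult_left_mono power_mono) (auto simp: algebra_simps)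
    finally show ?thesis .
  qed
  let ?bad = "{\<omega> \<in> {..<T} \<rightarrow>\<^sub>E K. \<exists>V\<subseteq>{..<m}. m \<le> 2 * k * card V \<and> card {t \<in> {..<T}. \<omega> t \<subseteq> V} < m}"
  have "1 \<le> 2 * k * k" using assms(1) by (simp add: Suc_le_eq)
  then have "1 \<le> real (2 * k * k)" by (metis of_nat_1 of_nat_mono)
  then have "p \<le> 1" unfolding p_def by (intro power_le_one) (auto simp: field_simps)
  have "?bad = (\<Union>V\<in>?\<V>. ?few V)" by auto
  then have "card ?bad \<le> (\<Sum>V\<in>?\<V>. card (?few V))"
    using card_UN_le[of ?\<V> ?few] by auto
  also have "real \<dots> \<le> (\<Sum>V\<in>?\<V>. 2 ^ m * (N * (1 - p / 2)) ^ T)"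
    unfolding of_nat_sum by (intro sum_mono few)
  also have "\<dots> = card ?\<V> * (2 ^ m * (N * (1 - p / 2)) ^ T)" by simp
  also have "\<dots> \<le> 2 ^ m * (2 ^ m * (N * (1 - p / 2)) ^ T)"
  proof (rule mult_right_mono)
    have "card ?\<V> \<le> card (Pow {..<m})" by (intro card_mono) auto
    then have "real (card ?\<V>) \<le> real (2 ^ m)" by (intro of_nat_mono) (simp add: card_Pow)
    then show "card ?\<V> \<le> (2 ^ m :: real)" by simp
  qed (use \<open>p \<le> 1\<close> in \<open>auto simp: N_def\<close>)
  also have "\<dots> = N ^ T * (4 * (1 - p / 2) ^ C) ^ m"
  proof -
    have "(4::real) ^ m = 2 ^ m * 2 ^ m" by (simp flip: power_mult_distrib)
    then show ?thesis by (simp add: T_def power_mult_distrib power_mult)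
  qed
  finally show ?thesis by (simp add: T_def N_def)
qed

text \<open>Markov's inequality for the degrees, whose sum is \<open>k * T\<close>.\<close>

lemma card_high_degree_le:
  fixes \<omega> :: "nat \<Rightarrow> nat set"
  assumes "\<And>t. t < T \<Longrightarrow> \<omega> t \<subseteq> {..<m} \<and> card (\<omega> t) = k"
  shows "D * card {x \<in> {..<m}. card {t \<in> {..<T}. x \<in> \<omega> t} > D} \<le> k * T"
proof -
  let ?U = "{x \<in> {..<m}. card {t \<in> {..<T}. x \<in> \<omega> t} > D}"
  have "D * card ?U = (\<Sum>x\<in>?U. D)" by simp
  also have "\<dots> \<le> (\<Sum>x\<in>?U. card {t \<in> {..<T}. x \<in> \<omega> t})" by (intro sum_mono) auto
  also have "\<dots> \<le> (\<Sum>x<m. card {t \<in> {..<T}. x \<in> \<omega> t})" by (intro sum_mono2) auto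
  also have "\<dots> = (\<Sum>t<T. k)"
  proof (rule sum_multicount_gen, simp, simp, intro ballI)
    fix t assume "t \<in> {..<T}"
    then have "{x \<in> {..<m}. x \<in> \<omega> t} = \<omega> t" using assms by auto
    then show "card {x \<in> {..<m}. x \<in> \<omega> t} = k" using assms \<open>t \<in> {..<T}\<close> by simp
  qed
  finally show ?thesis by (simp add: mult.commute)
qed

section \<open>Bounded degree hypergraphs with unique neighbours and dense large sets\<close>

text \<open>The unique neighbour clause lets the labels of few hyperedges be prescribed freely. In
  the last clause, m / k is the size guaranteed for the most frequent of k colours on m
  vertices.\<close>

definition expanding :: "nat \<Rightarrow> real \<Rightarrow> nat \<Rightarrow> nat \<Rightarrow> nat set set \<Rightarrow> bool" where
  "expanding k \<delta> D m B \<longleftrightarrow> B \<subseteq> {e. e \<subseteq> {..<m} \<and> card e = k} \<and>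
    (\<forall>x<m. card {e \<in> B. x \<in> e} \<le> D) \<and>
    (\<forall>F\<subseteq>B. F \<noteq> {} \<longrightarrow> real (card F) \<le> \<delta> * real m \<longrightarrow> (\<exists>e\<in>F. \<exists>x\<in>e. \<forall>e'\<in>F. x \<in> e' \<longrightarrow> e' = e)) \<and>
    (\<forall>V\<subseteq>{..<m}. m \<le> k * card V \<longrightarrow> m \<le> card {e \<in> B. e \<subseteq> V})"

text \<open>Among sequences of \<open>C * m\<close> hyperedges at most 1/3 violate expansion and at
  most 1/4 violate density, so some sequence is good. Deleting its hyperedges at vertices of high
  degree bounds the degrees, preserves unique neighbours and keeps enough density.\<close>

lemma expanding_exists:
  assumes k: "k \<ge> 3"
  shows "\<exists>\<delta> D M. \<delta> > 0 \<and> D > 0 \<and> (\<forall>m\<ge>M. \<exists>B. expanding k \<delta> D m B)"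
proof -
  define p :: real where "p = (1 / (2 * k * k)) ^ k"
  have "p > 0" using k by (simp add: p_def)
  have "1 \<le> 2 * k * k" using k by (simp add: Suc_le_eq)
  then have "1 \<le> real (2 * k * k)" by (metis of_nat_1 of_nat_mono)
  then have "p \<le> 1" unfolding p_def by (intro power_le_one) (auto simp: field_simps)
  note p = \<open>p > 0\<close> \<open>p \<le> 1\<close>
  \<comment> \<open>The value 1/16 compensates the factor 4 in \<open>card_sparse_le\<close> and
    leaves 1/4; the successor below ensures C \<ge> 1.\<close>
  obtain C' where C': "(1 - p / 2) ^ C' < 1 / 16"
    using real_arch_pow_inv[of "1 / 16" "1 - p / 2"] p by auto
  define C where "C = Suc C'"
  have C: "C \<ge> 1" "4 * (1 - p / 2) ^ C \<le> 1 / 4"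
  proof -
    have "(1 - p / 2) * (1 - p / 2) ^ C' \<le> 1 * (1 - p / 2) ^ C'"
      using p by (intro mult_right_mono) auto
    then show "4 * (1 - p / 2) ^ C \<le> 1 / 4" using C' by (simp add: C_def)
  qed (simp add: C_def)
  define Q where "Q = exp 1 * C * (exp 1 * k / 2) powr (3 / 2)"
  have Q: "Q > 0" using C k by (simp add: Q_def)
  \<comment> \<open>The two entries of the minimum meet the two smallness conditions of
    \<open>card_nonexpanding_le\<close>.\<close>
  define \<delta> where "\<delta> = min (2 / (exp 1 * k)) ((1 / (4 * Q))\<^sup>2)"
  have \<delta>: "\<delta> > 0" "exp 1 * k * \<delta> \<le> 2" "Q * sqrt \<delta> \<le> 1 / 4"
  proof -
    show "\<delta> > 0" using Q k by (simp add: \<delta>_def)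
    have "\<delta> \<le> 2 / (exp 1 * k)" by (simp add: \<delta>_def)
    then show "exp 1 * k * \<delta> \<le> 2" using k by (simp add: field_simps)
    have "sqrt \<delta> \<le> sqrt ((1 / (4 * Q))\<^sup>2)" by (intro real_sqrt_le_mono) (simp add: \<delta>_def)
    then have "sqrt \<delta> \<le> 1 / (4 * Q)" using Q by simp
    then show "Q * sqrt \<delta> \<le> 1 / 4" using Q by (simp add: field_simps)
  qed
  \<comment> \<open>With this D, \<open>card_high_degree_le\<close> leaves at most m / (2k) vertices
    of degree above D.\<close>
  define D where "D = 2 * k * k * C"
  \<comment> \<open>The first entry serves \<open>card_sparse_le\<close>; the second gives
    \<open>2 \<le> \<delta> * m\<close>, so that expansion applies to pairs of positions.\<close>
  define M where "M = max (2 * k * k) (nat \<lceil>2 / \<delta>\<rceil>)"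
  have "\<exists>B. expanding k \<delta> D m B" if m: "m \<ge> M" for m
  proof -
    have m1: "m \<ge> 2 * k * k" using m by (simp add: M_def)
    have "2 / \<delta> \<le> m" using m by (simp add: M_def)
    then have m2: "2 \<le> \<delta> * m" using \<delta>(1) by (simp add: pos_divide_le_eq mult.commute)
    have "2 * k * k \<ge> k" by simp
    then have m3: "m \<ge> k" "m \<ge> 1" using m1 k by linarith+
    define T where "T = C * m"
    define K where "K = {e. e \<subseteq> {..<m} \<and> card e = k}"
    have finK: "finite K" by (rule finite_subset[of _ "Pow {..<m}"]) (auto simp: K_def)
    have cardK: "card K > 0" unfolding K_def using n_subsets[of "{..<m}" k] m3 by simp
    define \<Omega> where "\<Omega> = {..<T} \<rightarrow>\<^sub>E K"
    define bad1 where "bad1 = {\<omega> \<in> \<Omega>. \<exists>F\<subseteq>{..<T}. F \<noteq> {} \<and> card F \<le> \<delta> * m \<and>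
      2 * card (\<Union>t\<in>F. \<omega> t) \<le> k * card F}"
    define bad2 where "bad2 = {\<omega> \<in> \<Omega>. \<exists>V\<subseteq>{..<m}. m \<le> 2 * k * card V \<and>
      card {t \<in> {..<T}. \<omega> t \<subseteq> V} < m}"
    have pos: "real (card K) ^ T > 0" using cardK by simp
    have card1: "card bad1 \<le> real (card K) ^ T / 3"
      unfolding bad1_def \<Omega>_def T_def K_def
      by (rule card_nonexpanding_le[OF k m3(2) C(1) \<delta>(2) \<delta>(3)[unfolded Q_def]])
    have "card bad2 \<le> real (card K) ^ T * (4 * (1 - p / 2) ^ C) ^ m"
      unfolding bad2_def \<Omega>_def T_def K_def p_def by (rule card_sparse_le[OF _ m1]) (use k in simp)
    also have "\<dots> \<le> real (card K) ^ T * (1 / 4) ^ 1"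
    proof (rule mult_left_mono)
      have "(4 * (1 - p / 2) ^ C) ^ m \<le> (1 / 4) ^ m" using p C by (intro power_mono) auto
      also have "\<dots> \<le> (1 / 4) ^ 1" using m3 by (intro power_decreasing) auto
      finally show "(4 * (1 - p / 2) ^ C) ^ m \<le> (1 / 4) ^ 1" .
    qed simp
    finally have card2: "card bad2 \<le> real (card K) ^ T * (1 / 4)" by simp
    have "card \<Omega> = card K ^ T" by (simp add: \<Omega>_def card_PiE)
    then have "real (card \<Omega>) = real (card K) ^ T" by simp
    then have "real (card bad1 + card bad2) < real (card \<Omega>)"
      unfolding of_nat_add using card1 card2 pos by linarith
    then have "card bad1 + card bad2 < card \<Omega>" by (simp only: of_nat_less_iff)
    with card_Un_le have "card (bad1 \<union> bad2) < card \<Omega>" by (rule le_less_trans)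
    moreover have "finite (bad1 \<union> bad2)"
    proof (rule finite_subset)
      show "bad1 \<union> bad2 \<subseteq> \<Omega>" unfolding bad1_def bad2_def by blast
      show "finite \<Omega>" using finK by (auto simp: \<Omega>_def intro!: finite_PiE)
    qed
    ultimately have "\<not> \<Omega> \<subseteq> bad1 \<union> bad2"
      by (meson card_mono not_le)
    then obtain \<omega> where \<omega>: "\<omega> \<in> \<Omega>" "\<omega> \<notin> bad1" "\<omega> \<notin> bad2" by blast
    have expand: "k * card F < 2 * card (\<Union>t\<in>F. \<omega> t)"
      if "F \<subseteq> {..<T}" "F \<noteq> {}" "card F \<le> \<delta> * m" for F
    proof (rule ccontr)
      assume "\<not> k * card F < 2 * card (\<Union>t\<in>F. \<omega> t)"
      then have "2 * card (\<Union>t\<in>F. \<omega> t) \<le> k * card F" by (simp only: not_less)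
      then have "\<omega> \<in> bad1" unfolding bad1_def using \<omega>(1) that by blast
      then show False using \<omega>(2) by blast
    qed
    have dense: "m \<le> card {t \<in> {..<T}. \<omega> t \<subseteq> V}" if "V \<subseteq> {..<m}" "m \<le> 2 * k * card V" for V
    proof (rule ccontr)
      assume "\<not> m \<le> card {t \<in> {..<T}. \<omega> t \<subseteq> V}"
      then have "card {t \<in> {..<T}. \<omega> t \<subseteq> V} < m" by (simp only: not_le)
      then have "\<omega> \<in> bad2" unfolding bad2_def using \<omega>(1) that by blast
      then show False using \<omega>(3) by blast
    qed
    have \<omega>K: "\<omega> t \<subseteq> {..<m} \<and> card (\<omega> t) = k" if "t < T" for t
      using \<omega>(1) that by (auto simp: \<Omega>_def K_def PiE_iff)
    have fin\<omega>: "finite (\<omega> t)" if "t < T" for t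
      using \<omega>K[OF that] finite_subset[of "\<omega> t" "{..<m}"] by simp
    have uniq: "\<exists>t\<in>F. \<exists>x\<in>\<omega> t. \<forall>t'\<in>F. x \<in> \<omega> t' \<longrightarrow> t' = t"
      if F: "F \<subseteq> {..<T}" "F \<noteq> {}" "card F \<le> \<delta> * m" for F
    proof (rule unique_neighbour_if_expanding)
      show "finite F" using finite_subset[OF F(1)] by simp
      show "finite (\<omega> t) \<and> card (\<omega> t) = k" if "t \<in> F" for t
        using \<omega>K[of t] fin\<omega>[of t] F that by auto
      show "k * card F < 2 * card (\<Union>t\<in>F. \<omega> t)"
        by (rule expand[OF F])
    qed
    \<comment> \<open>Two positions with the same hyperedge would form a pair without a unique
      neighbour. Hence counts of positions become counts of hyperedges.\<close>
    have inj: "inj_on \<omega> {..<T}"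
    proof (rule inj_onI, rule ccontr)
      fix t t' assume t: "t \<in> {..<T}" "t' \<in> {..<T}" "\<omega> t = \<omega> t'" "t \<noteq> t'"
      have "\<exists>s\<in>{t, t'}. \<exists>x\<in>\<omega> s. \<forall>s'\<in>{t, t'}. x \<in> \<omega> s' \<longrightarrow> s' = s"
        using t m2 by (intro uniq) auto
      then show False using t by auto
    qed
    define U where "U = {x \<in> {..<m}. card {t \<in> {..<T}. x \<in> \<omega> t} > D}"
    have "D * card U \<le> k * T"
      unfolding U_def by (intro card_high_degree_le \<omega>K)
    then have "(k * C) * (2 * k * card U) \<le> (k * C) * m"
      by (simp only: D_def T_def mult_ac)
    then have U: "2 * k * card U \<le> m" using k C by simp
    \<comment> \<open>The hyperedges kept are those avoiding every vertex of high degree.\<close>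
    define J where "J = {t \<in> {..<T}. \<omega> t \<inter> U = {}}"
    have JT: "J \<subseteq> {..<T}" by (auto simp: J_def)
    have "expanding k \<delta> D m (\<omega> ` J)"
      unfolding expanding_def
    proof (intro conjI allI impI)
      show "\<omega> ` J \<subseteq> {e. e \<subseteq> {..<m} \<and> card e = k}" using \<omega>K JT by auto
    next
      fix x assume "x < m"
      show "card {e \<in> \<omega> ` J. x \<in> e} \<le> D"
      proof (cases "x \<in> U")
        case True
        then have "{e \<in> \<omega> ` J. x \<in> e} = {}" by (auto simp: J_def)
        then show ?thesis by (metis card.empty le0)
      next
        case False
        have "card {e \<in> \<omega> ` J. x \<in> e} \<le> card (\<omega> ` {t \<in> {..<T}. x \<in> \<omega> t})"
          by (rule card_mono) (simp, use JT in blast)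
        also have "\<dots> \<le> card {t \<in> {..<T}. x \<in> \<omega> t}" by (rule card_image_le) simp
        also have "\<dots> \<le> D" using False \<open>x < m\<close> by (auto simp: U_def)
        finally show ?thesis .
      qed
    next
      fix F assume F: "F \<subseteq> \<omega> ` J" "F \<noteq> {}" "card F \<le> \<delta> * m"
      then obtain G where G: "G \<subseteq> J" "F = \<omega> ` G" by (auto simp: subset_image_iff)
      have "card F = card G" using G inj JT by (metis card_image inj_on_subset)
      then have "real (card G) \<le> \<delta> * m" "G \<noteq> {}" using F(2,3) G(2) by auto
      then have "\<exists>t\<in>G. \<exists>x\<in>\<omega> t. \<forall>t'\<in>G. x \<in> \<omega> t' \<longrightarrow> t' = t"
        using G(1) JT by (intro uniq) auto
      then show "\<exists>e\<in>F. \<exists>x\<in>e. \<forall>e'\<in>F. x \<in> e' \<longrightarrow> e' = e"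
        unfolding G by blast
    next
      fix V assume V: "V \<subseteq> {..<m}" "m \<le> k * card V"
      \<comment> \<open>Of the at least m / k vertices of V at most m / (2k) lie in U, and every
        hyperedge inside \<open>V - U\<close> is kept.\<close>
      have "card V - card U \<le> card (V - U)" by (rule diff_card_le_card_Diff) (simp add: U_def)
      then have "2 * k * card V \<le> 2 * k * (card (V - U) + card U)" by (intro mult_left_mono) auto
      then have "m \<le> 2 * k * card (V - U)" using V U by (simp add: algebra_simps)
      then have "m \<le> card {t \<in> {..<T}. \<omega> t \<subseteq> V - U}"
        using V(1) by (intro dense) auto
      also have "\<dots> = card (\<omega> ` {t \<in> {..<T}. \<omega> t \<subseteq> V - U})"
        by (rule card_image[symmetric], rule inj_on_subset[OF inj]) blast
      also have "\<dots> \<le> card {e \<in> \<omega> ` J. e \<subseteq> V}"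
      proof (rule card_mono)
        show "finite {e \<in> \<omega> ` J. e \<subseteq> V}" using finite_subset[OF JT] by simp
        show "\<omega> ` {t \<in> {..<T}. \<omega> t \<subseteq> V - U} \<subseteq> {e \<in> \<omega> ` J. e \<subseteq> V}"
          by (auto simp: J_def)
      qed
      finally show "m \<le> card {e \<in> \<omega> ` J. e \<subseteq> V}" .
    qed
    then show ?thesis by blast
  qed
  moreover have "D > 0" using k C by (simp add: D_def)
  ultimately show ?thesis using \<delta>(1) by blast
qed

section \<open>Lifts to cyclic groups\<close>

text \<open>Peeling: some hyperedge e has a vertex x that no other hyperedge of F contains. Solve
  the system without e by induction, then change the value at x alone to satisfy e; the coefficient
  1 of this value keeps the solution integral.\<close>

lemma integer_system_solvable:
  fixes a :: "'a set \<Rightarrow> int"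
  assumes "finite F" "\<And>e. e \<in> F \<Longrightarrow> finite e"
    and "\<And>F'. F' \<subseteq> F \<Longrightarrow> F' \<noteq> {} \<Longrightarrow> \<exists>e\<in>F'. \<exists>x\<in>e. \<forall>e'\<in>F'. x \<in> e' \<longrightarrow> e' = e"
  shows "\<exists>h. \<forall>e\<in>F. (\<Sum>x\<in>e. h x) = a e"
  using assms
proof (induction "card F" arbitrary: F)
  case 0
  then show ?case by auto
next
  case (Suc n)
  then have "F \<noteq> {}" by auto
  then obtain e x where ex: "e \<in> F" "x \<in> e" "\<And>e'. e' \<in> F \<Longrightarrow> x \<in> e' \<Longrightarrow> e' = e"
    using Suc.prems(3)[of F] by blast
  have "\<exists>h. \<forall>e\<in>F - {e}. (\<Sum>x\<in>e. h x) = a e"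
    using Suc.hyps(2) Suc.prems ex(1) by (intro Suc.hyps(1)) auto
  then obtain h where h: "\<And>e'. e' \<in> F \<Longrightarrow> e' \<noteq> e \<Longrightarrow> (\<Sum>x\<in>e'. h x) = a e'" by auto
  define h' where "h' = h(x := a e - (\<Sum>y\<in>e - {x}. h y))"
  have "(\<Sum>x\<in>e'. h' x) = a e'" if "e' \<in> F" for e'
  proof (cases "e' = e")
    case True
    have "(\<Sum>y\<in>e. h' y) = h' x + (\<Sum>y\<in>e - {x}. h' y)"
      using Suc.prems(2)[OF ex(1)] ex(2) by (rule sum.remove)
    also have "(\<Sum>y\<in>e - {x}. h' y) = (\<Sum>y\<in>e - {x}. h y)"
      by (intro sum.cong) (auto simp: h'_def)
    finally show ?thesis using True by (simp add: h'_def)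
  next
    case False
    then have "x \<notin> e'" using ex(3) that by blast
    then have "(\<Sum>x\<in>e'. h' x) = (\<Sum>x\<in>e'. h x)" by (intro sum.cong) (auto simp: h'_def)
    then show ?thesis using h False that by simp
  qed
  then show ?case by blast
qed

text \<open>The vertex \<open>x * k + s + 1\<close> encodes the pair \<open>(x, s)\<close> with \<open>s < k\<close>.\<close>

definition base :: "nat \<Rightarrow> nat \<Rightarrow> nat" where
  "base k v = (v - 1) div k"

definition shift :: "nat \<Rightarrow> nat \<Rightarrow> int" where
  "shift k v = int ((v - 1) mod k)"

text \<open>Injectivity of \<open>base k\<close> makes h contain exactly one vertex above each
  vertex of its image in B. Labels are integers read modulo k, so integral corrections can be added
  to them directly.\<close>

definition lift :: "nat \<Rightarrow> nat \<Rightarrow> nat set set \<Rightarrow> (nat set \<Rightarrow> int) \<Rightarrow> nat set set" where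
  "lift k m B a = {h. h \<subseteq> {1..k * m} \<and> inj_on (base k) h \<and> base k ` h \<in> B \<and>
     [(\<Sum>v\<in>h. shift k v) = a (base k ` h)] (mod int k)}"

section \<open>Degrees, colourings and distance of lifts\<close>

text \<open>The condition \<open>v \<ge> 1\<close> excludes 0, which truncated subtraction would
  also place above the vertex 0.\<close>

lemma card_lift_fibre_le:
  assumes "finite e" "k > 0"
  shows "finite {v. v \<ge> 1 \<and> base k v \<in> e}" "card {v. v \<ge> 1 \<and> base k v \<in> e} \<le> card e * k"
proof -
  have *: "{v. v \<ge> 1 \<and> base k v \<in> e} \<subseteq> (\<lambda>(x, s). x * k + s + 1) ` (e \<times> {..<k})"
  proof
    fix v assume "v \<in> {v. v \<ge> 1 \<and> base k v \<in> e}"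
    then have "v = (\<lambda>(x, s). x * k + s + 1) (base k v, (v - 1) mod k)"
      "(base k v, (v - 1) mod k) \<in> e \<times> {..<k}" using assms by (auto simp: base_def)
    then show "v \<in> (\<lambda>(x, s). x * k + s + 1) ` (e \<times> {..<k})" by blast
  qed
  show "finite {v. v \<ge> 1 \<and> base k v \<in> e}"
    by (rule finite_subset[OF *]) (use assms in auto)
  have "card {v. v \<ge> 1 \<and> base k v \<in> e} \<le> card (e \<times> {..<k})"
    using assms by (intro surj_card_le[OF _ *]) auto
  then show "card {v. v \<ge> 1 \<and> base k v \<in> e} \<le> card e * k" by (simp add: card_cartesian_product)
qed

text \<open>A hyperedge at v lies above one of at most D hyperedges of B through
  \<open>base k v\<close>, and it is a subset of the at most \<open>k * k\<close> vertices above
  that one. This crude count suffices, as it does not depend on n.\<close>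

lemma bounded_hypergraph_lift:
  assumes k: "k > 0" and B: "B \<subseteq> {e. e \<subseteq> {..<m} \<and> card e = k}"
    and deg: "\<And>x. x < m \<Longrightarrow> card {e \<in> B. x \<in> e} \<le> D" and n: "k * m \<le> n"
  shows "bounded_hypergraph k (D * 2 ^ (k * k)) n (lift k m B a)"
  unfolding bounded_hypergraph_def uniform_hypergraph_def max_degree_le_def
proof (intro conjI ballI subsetI)
  fix h assume "h \<in> lift k m B a"
  then have h: "h \<subseteq> {1..k * m}" "inj_on (base k) h" "base k ` h \<in> B" by (auto simp: lift_def)
  then have "card h = k" using B card_image[OF h(2)] by auto
  then show "h \<in> all_edges k n" using h n by (auto simp: all_edges_def)
next
  fix v
  let ?Bv = "{e \<in> B. base k v \<in> e}"
  let ?f = "\<lambda>e. {w. w \<ge> 1 \<and> base k w \<in> e}"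
  have finB: "finite B" using B by (rule finite_subset) auto
  have e: "finite e \<and> card e = k" if "e \<in> B" for e
  proof -
    have "e \<subseteq> {..<m}" "card e = k" using that B by auto
    then show ?thesis using finite_subset[of e "{..<m}"] by simp
  qed
  have *: "incident_edges (lift k m B a) v \<subseteq> (\<Union>e\<in>?Bv. Pow (?f e))"
  proof
    fix h assume "h \<in> incident_edges (lift k m B a) v"
    then have h: "v \<in> h" "h \<subseteq> {1..k * m}" "base k ` h \<in> B"
      by (simp_all add: incident_edges_def lift_def)
    then have "base k ` h \<in> ?Bv" "h \<in> Pow (?f (base k ` h))" by auto
    then show "h \<in> (\<Union>e\<in>?Bv. Pow (?f e))" by blast
  qed
  have "card (incident_edges (lift k m B a) v) \<le> card (\<Union>e\<in>?Bv. Pow (?f e))"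
  proof (rule card_mono[OF _ *])
    show "finite (\<Union>e\<in>?Bv. Pow (?f e))"
    proof (rule finite_UN_I)
      show "finite (Pow (?f e))" if "e \<in> ?Bv" for e
        using card_lift_fibre_le(1)[of e k] e[of e] that k by simp
    qed (use finB in simp)
  qed
  also have "\<dots> \<le> (\<Sum>e\<in>?Bv. card (Pow (?f e)))"
    by (rule card_UN_le) (use finB in simp)
  also have "\<dots> \<le> (\<Sum>e\<in>?Bv. 2 ^ (k * k))"
  proof (rule sum_mono)
    fix e assume "e \<in> ?Bv"
    then have "finite (?f e)" "card (?f e) \<le> k * k" using card_lift_fibre_le[of e k] e[of e] k by simp_all
    then show "card (Pow (?f e)) \<le> 2 ^ (k * k)" by (simp add: card_Pow power_increasing)
  qed
  also have "\<dots> = card ?Bv * 2 ^ (k * k)" by simp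
  also have "\<dots> \<le> D * 2 ^ (k * k)"
  proof (cases "base k v < m")
    case False
    then have "?Bv = {}" using B by auto
    then show ?thesis by (simp only: card.empty)
  qed (auto intro: deg)
  finally show "card (incident_edges (lift k m B a) v) \<le> D * 2 ^ (k * k)" .
qed

text \<open>Locality: the hyperedges at v depend only on the labels, modulo k, of the hyperedges of
  B through \<open>base k v\<close>.\<close>

lemma incident_edges_lift_cong:
  assumes "\<And>e. e \<in> B \<Longrightarrow> base k v \<in> e \<Longrightarrow> [a e = a' e] (mod int k)"
  shows "incident_edges (lift k m B a) v = incident_edges (lift k m B a') v"
proof -
  have "[(\<Sum>v\<in>h. shift k v) = a (base k ` h)] (mod int k) \<longleftrightarrow>
      [(\<Sum>v\<in>h. shift k v) = a' (base k ` h)] (mod int k)"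
    if "v \<in> h" "base k ` h \<in> B" for h
    using assms[OF that(2)] that(1) by (meson cong_sym cong_trans imageI)
  then show ?thesis by (auto simp: incident_edges_def lift_def)
qed

lemma colorable_lift:
  assumes k: "k \<ge> 2" and B: "B \<subseteq> {e. e \<subseteq> {..<m} \<and> card e = k}"
  shows "colorable k n (lift k m B (\<lambda>e. 1 + (\<Sum>x\<in>e. g x)))"
proof -
  \<comment> \<open>The residue of s - g x, moved by one from 0..k-1 to the colours 1..k.\<close>
  define f where "f v = nat ((shift k v - g (base k v)) mod int k) + 1" for v
  have "f \<in> {1..n} \<rightarrow> {1..k}" using k by (auto simp: f_def Suc_le_eq nat_less_iff)
  moreover have "\<exists>u\<in>h. \<exists>v\<in>h. f u \<noteq> f v" if "h \<in> lift k m B (\<lambda>e. 1 + (\<Sum>x\<in>e. g x))" for h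
  proof (rule ccontr)
    assume neg: "\<not> ?thesis"
    have h: "inj_on (base k) h" "base k ` h \<in> B"
      and cong: "[(\<Sum>v\<in>h. shift k v) = 1 + (\<Sum>x\<in>base k ` h. g x)] (mod int k)"
      using that by (auto simp: lift_def)
    have cardh: "card h = k" using B h card_image[OF h(1)] by auto
    then obtain u where u: "u \<in> h" using k by fastforce
    have c: "[shift k v - g (base k v) = shift k u - g (base k u)] (mod int k)" if v: "v \<in> h" for v
    proof -
      have "f v = f u" using neg u v by blast
      then show ?thesis using k by (simp add: f_def cong_def eq_nat_nat_iff)
    qed
    have "[(\<Sum>v\<in>h. shift k v - g (base k v)) = (\<Sum>v\<in>h. shift k u - g (base k u))] (mod int k)"
      by (rule cong_sum) (rule c)
    moreover have "(\<Sum>v\<in>h. shift k v - g (base k v)) = (\<Sum>v\<in>h. shift k v) - (\<Sum>x\<in>base k ` h. g x)"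
      using h(1) by (simp add: sum_subtractf sum.reindex)
    moreover have "[(\<Sum>v\<in>h. shift k v) - (\<Sum>x\<in>base k ` h. g x) = 1] (mod int k)"
      using cong_diff[OF cong cong_refl[of "\<Sum>x\<in>base k ` h. g x"]] by simp
    \<comment> \<open>On a monochromatic hyperedge the k congruent summands add up to a multiple of
      k, which cannot be 1 modulo k \<ge> 2.\<close>
    ultimately have "[1 = int k * (shift k u - g (base k u))] (mod int k)"
      using cardh by (simp add: cong_sym_eq) (metis cong_sym cong_trans)
    then show False using k by (auto simp: cong_def)
  qed
  ultimately show ?thesis unfolding colorable_def by blast
qed

text \<open>The vertices \<open>w x\<close> encoding (x, g x) span a copy of B in the lift. In a
  proper colouring of E' some colour occurs on at least m / k of them, so m hyperedges of the copy
  are monochromatic and missing from E'.\<close>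

lemma far_from_lift:
  assumes k: "k > 0" and \<Delta>: "\<Delta> > 0" and B: "expanding k \<delta> D m B" and m: "m > 0"
    and n: "k * m \<le> n" "n \<le> 2 * k * m"
    and g: "\<And>x. x < m \<Longrightarrow> g x \<in> {0..<int k}"
  shows "far_from k \<Delta> (1 / real (4 * k * \<Delta>)) (colorable k) n (lift k m B (\<lambda>e. \<Sum>x\<in>e. g x))"
  unfolding far_from_def
proof (intro allI impI)
  let ?E = "lift k m B (\<lambda>e. \<Sum>x\<in>e. g x)"
  fix E' assume E': "uniform_hypergraph k n E' \<and> colorable k n E'"
  then obtain f where f: "f \<in> {1..n} \<rightarrow> {1..k}" "\<forall>e\<in>E'. \<exists>u\<in>e. \<exists>v\<in>e. f u \<noteq> f v"
    by (auto simp: colorable_def)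
  define w where "w x = x * k + nat (g x) + 1" for x
  have w: "base k (w x) = x" "shift k (w x) = g x" "w x \<in> {1..k * m}" if "x < m" for x
  proof -
    have gx: "nat (g x) < k" "0 \<le> g x" using g[OF that] by auto
    then show "base k (w x) = x" "shift k (w x) = g x" by (auto simp: w_def base_def shift_def)
    have "Suc x * k \<le> m * k" using that by (intro mult_right_mono) auto
    then show "w x \<in> {1..k * m}" using gx by (auto simp: w_def mult.commute)
  qed
  obtain c where c: "m \<le> k * card {x \<in> {..<m}. f (w x) = c}"
  proof -
    have "(\<lambda>x. f (w x)) \<in> {..<m} \<rightarrow> {1..k}" using f(1) w(3) n by fastforce
    then obtain c where "card {..<m} \<le> card ((\<lambda>x. f (w x)) -` {c} \<inter> {..<m}) * card {1..k}"
      using pigeonhole_card[of "\<lambda>x. f (w x)" "{..<m}" "{1..k}"] k by auto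
    moreover have "(\<lambda>x. f (w x)) -` {c} \<inter> {..<m} = {x \<in> {..<m}. f (w x) = c}" by auto
    ultimately have "m \<le> k * card {x \<in> {..<m}. f (w x) = c}" by (simp add: mult.commute)
    then show ?thesis by (rule that)
  qed
  let ?V = "{x \<in> {..<m}. f (w x) = c}"
  have "?V \<subseteq> {..<m}" by blast
  then have "m \<le> card {e \<in> B. e \<subseteq> ?V}" using B c unfolding expanding_def by blast
  also have "\<dots> \<le> card (?E - E')"
  proof (rule card_inj_on_le[where f = "image w"])
    have "base k ` w ` e = e" if "e \<subseteq> {..<m}" for e
      using w(1) that by (force simp: image_image)
    then show "inj_on ((`) w) {e \<in> B. e \<subseteq> ?V}"
      by (intro inj_on_inverseI[where g = "image (base k)"]) auto
    show "(`) w ` {e \<in> B. e \<subseteq> ?V} \<subseteq> ?E - E'"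
    proof
      fix h assume "h \<in> (`) w ` {e \<in> B. e \<subseteq> ?V}"
      then obtain e where e: "e \<in> B" "e \<subseteq> ?V" and h: "h = w ` e" by blast
      have injw: "inj_on w e" using w(1) e by (intro inj_on_inverseI[where g = "base k"]) auto
      have im: "base k ` w ` e = e" using w(1) e by (force simp: image_image)
      have "(\<Sum>v\<in>w ` e. shift k v) = (\<Sum>x\<in>e. g x)"
        using injw e w(2) by (auto simp: sum.reindex intro!: sum.cong)
      moreover have "inj_on (base k) (w ` e)"
        using w(1) e by (intro inj_on_inverseI[where g = w]) auto
      ultimately have "w ` e \<in> ?E" using im e w(3) by (auto simp: lift_def)
      moreover have "w ` e \<notin> E'"
      proof
        assume "w ` e \<in> E'"
        then obtain u v where "u \<in> w ` e" "v \<in> w ` e" "f u \<noteq> f v" using f(2) by blast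
        then show False using e by auto
      qed
      ultimately show "h \<in> ?E - E'" using h by simp
    qed
    show "finite (?E - E')" by (rule finite_subset[of _ "Pow {1..k * m}"]) (auto simp: lift_def)
  qed
  finally have mE: "m \<le> card (?E - E')" .
  show "1 / real (4 * k * \<Delta>) < hypergraph_dist \<Delta> n ?E E'"
  proof -
    \<comment> \<open>This bounds m / (\<Delta> n) below by 1 / (2k\<Delta>); the constant 4 in
      place of 2 makes the inequality strict.\<close>
    have "real n \<le> real (2 * k * m)" using n(2) by (rule of_nat_mono)
    moreover have n0: "n > 0" using n(1) k m by (metis gr0I le_zero_eq mult_eq_0_iff)
    ultimately have "1 / real (4 * k * \<Delta>) < m / (real \<Delta> * real n)"
      using k \<Delta> m by (simp add: field_simps)
    also have "\<dots> \<le> hypergraph_dist \<Delta> n ?E E'"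
      unfolding hypergraph_dist_def using mE by (intro divide_right_mono) auto
    finally show ?thesis .
  qed
qed

section \<open>Runs of query trees\<close>

lemma incidence_oracle_cong:
  assumes "incident_edges E v = incident_edges E' v"
  shows "incidence_oracle \<Delta> r n E v j = incidence_oracle \<Delta> r n E' v j"
  using assms by (simp add: incidence_oracle_def padded_list_def incidence_list_def)

text \<open>Only the vertices of the queries are recorded, since the hyperedges incident to v
  determine every answer at v.\<close>

primrec queried :: "(nat \<Rightarrow> nat \<Rightarrow> nat set option) \<Rightarrow> query_tree \<Rightarrow> nat set" where
  "queried orc (Answer b) = {}"
| "queried orc (Query v j next) = insert v (queried orc (next (orc v j)))"

lemma finite_queried: "finite (queried orc t)"
  by (induction t) auto

lemma card_queried_le: "card (queried orc t) \<le> num_queries orc t"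
proof (induction t)
  case (Query v j nxt)
  have "card (insert v (queried orc (nxt (orc v j)))) \<le> Suc (card (queried orc (nxt (orc v j))))"
    by (rule card_insert_le_m1) simp_all
  then show ?case using Query.IH[of "nxt (orc v j)"] by (simp add: le_trans)
qed simp

text \<open>Agreement is required only along the run with \<open>orc\<close>: at each query both
  runs receive the same answer and enter the same subtree.\<close>

lemma same_run:
  assumes "\<And>v j. v \<in> queried orc t \<Longrightarrow> orc v j = orc' v j"
  shows "queried orc' t = queried orc t \<and> accepts orc' t = accepts orc t"
  using assms
proof (induction t)
  case (Query v j nxt)
  have "orc' v j = orc v j" by (rule Query.prems[symmetric]) simp
  moreover have "queried orc' (nxt (orc v j)) = queried orc (nxt (orc v j)) \<and>
      accepts orc' (nxt (orc v j)) = accepts orc (nxt (orc v j))"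
    by (rule Query.IH[OF rangeI], rule Query.prems) simp
  ultimately show ?case by simp
qed simp

section \<open>An exhaustive tester\<close>

text \<open>The table of answers is built by updates inside the predicate; positions outside the
  list keep the default \<open>None\<close>.\<close>

primrec query_all :: "(nat \<times> nat) list \<Rightarrow> ((nat \<times> nat \<Rightarrow> nat set option) \<Rightarrow> bool) \<Rightarrow> query_tree" where
  "query_all [] P = Answer (P (\<lambda>_. None))"
| "query_all (p # ps) P = Query (fst p) (snd p) (\<lambda>a. query_all ps (\<lambda>tab. P (tab(p := a))))"

lemma accepts_query_all:
  "accepts orc (query_all ps P) = P (\<lambda>p. if p \<in> set ps then orc (fst p) (snd p) else None)"
proof (induction ps arbitrary: P)
  case (Cons p ps)
  have "(\<lambda>q. if q \<in> set ps then orc (fst q) (snd q) else None)(p := orc (fst p) (snd p)) =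
    (\<lambda>q. if q \<in> set (p # ps) then orc (fst q) (snd q) else None)"
    by (rule ext) simp
  then show ?case by (simp only: query_all.simps accepts.simps Cons.IH)
qed simp

lemma num_queries_query_all: "num_queries orc (query_all ps P) = length ps"
  by (induction ps arbitrary: P) auto

text \<open>A hyperedge is nonempty as k > 0, so it occurs in the list of one of its vertices, and
  the degree bound keeps that list within the \<Delta> entries that can be queried. Thus all answers
  together recover E.\<close>

lemma incidence_oracle_range:
  assumes E: "bounded_hypergraph k \<Delta> n E" and k: "k > 0" and r: "linear_order_on (all_edges k n) r"
  shows "e \<in> E \<longleftrightarrow> (\<exists>v\<in>{1..n}. \<exists>j\<in>{1..\<Delta>}. incidence_oracle \<Delta> r n E v j = Some e)"
proof -
  have EU: "E \<subseteq> all_edges k n" and deg: "\<And>v. v \<in> {1..n} \<Longrightarrow> card (incident_edges E v) \<le> \<Delta>"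
    using E by (auto simp: bounded_hypergraph_def uniform_hypergraph_def max_degree_le_def)
  have "finite (all_edges k n)" by (rule finite_subset[of _ "Pow {1..n}"]) (auto simp: all_edges_def)
  then have finE: "finite E" using EU finite_subset by blast
  have il: "set (incidence_list r E v) = incident_edges E v" "length (incidence_list r E v) = card (incident_edges E v)"
    for v
  proof -
    have "\<exists>!xs. set xs = incident_edges E v \<and> distinct xs \<and> sorted_wrt (\<lambda>e f. (e, f) \<in> r) xs"
      using finE EU by (intro ex1_sorted_list[OF _ _ r]) (auto simp: incident_edges_def)
    from theI'[OF this] have il: "set (incidence_list r E v) = incident_edges E v"
      "distinct (incidence_list r E v)" by (simp_all add: incidence_list_def)
    then show "set (incidence_list r E v) = incident_edges E v"
      "length (incidence_list r E v) = card (incident_edges E v)"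
      using distinct_card by fastforce+
  qed
  have orc: "incidence_oracle \<Delta> r n E v j =
      (if j \<le> length (incidence_list r E v) then Some (incidence_list r E v ! (j - 1)) else None)"
    if "v \<in> {1..n}" "j \<in> {1..\<Delta>}" for v j
    using that il(2)[of v] deg[of v]
    by (auto simp: incidence_oracle_def padded_list_def Let_def nth_append)
  show ?thesis
  proof
    assume e: "e \<in> E"
    then have "e \<subseteq> {1..n}" "card e = k" using EU by (auto simp: all_edges_def)
    then obtain v where v: "v \<in> e" "v \<in> {1..n}" using k by (metis card.empty ex_in_conv less_irrefl subsetD)
    then have "e \<in> set (incidence_list r E v)" using il e by (simp add: incident_edges_def)
    then obtain i where i: "i < length (incidence_list r E v)" "incidence_list r E v ! i = e"
      by (auto simp: in_set_conv_nth)
    then have "Suc i \<in> {1..\<Delta>}" using il(2)[of v] deg[OF v(2)] by simp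
    moreover from this have "incidence_oracle \<Delta> r n E v (Suc i) = Some e"
      using orc[OF v(2)] i by simp
    ultimately show "\<exists>v\<in>{1..n}. \<exists>j\<in>{1..\<Delta>}. incidence_oracle \<Delta> r n E v j = Some e"
      using v(2) by blast
  next
    assume "\<exists>v\<in>{1..n}. \<exists>j\<in>{1..\<Delta>}. incidence_oracle \<Delta> r n E v j = Some e"
    then obtain v j where vj: "v \<in> {1..n}" "j \<in> {1..\<Delta>}" "incidence_oracle \<Delta> r n E v j = Some e" by blast
    then have "j \<le> length (incidence_list r E v)" "e = incidence_list r E v ! (j - 1)"
      using orc[OF vj(1,2)] by (auto split: if_splits)
    moreover have "j - 1 < length (incidence_list r E v)" using vj(2) calculation(1) by auto
    ultimately have "e \<in> set (incidence_list r E v)" using nth_mem by metis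
    then show "e \<in> E" using il(1)[of v] by (simp add: incident_edges_def)
  qed
qed

text \<open>Querying every entry decides P exactly, and for \<epsilon> \<ge> 0 no hypergraph with P
  is \<epsilon>-far from it, its distance to itself being 0. This makes the infimum in the query
  complexity range over a nonempty set.\<close>

lemma tester_exists:
  assumes k: "k > 0" and r: "linear_order_on (all_edges k n) r" and "\<epsilon> \<ge> 0"
  shows "\<exists>q T. is_tester k \<Delta> \<epsilon> P r n T \<and> queries_at_most k \<Delta> r n T q"
proof -
  define ps where "ps = List.product [1..<Suc n] [1..<Suc \<Delta>]"
  have ps: "set ps = {1..n} \<times> {1..\<Delta>}" by (auto simp: ps_def)
  define T where "T = return_pmf (query_all ps (\<lambda>tab. P n {e. \<exists>p. tab p = Some e}))"
  have acc: "accept_prob (incidence_oracle \<Delta> r n E) T = (if P n E then 1 else 0)"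
    if "bounded_hypergraph k \<Delta> n E" for E
  proof -
    have "{e. \<exists>p. (if p \<in> set ps then incidence_oracle \<Delta> r n E (fst p) (snd p) else None) = Some e} = E"
    proof (rule set_eqI)
      fix e
      have "(\<exists>p. (if p \<in> set ps then incidence_oracle \<Delta> r n E (fst p) (snd p) else None) = Some e)
        \<longleftrightarrow> (\<exists>p\<in>set ps. incidence_oracle \<Delta> r n E (fst p) (snd p) = Some e)"
        by (metis option.distinct(1))
      also have "\<dots> \<longleftrightarrow> (\<exists>v\<in>{1..n}. \<exists>j\<in>{1..\<Delta>}. incidence_oracle \<Delta> r n E v j = Some e)"
        unfolding ps by force
      finally have "(\<exists>p. (if p \<in> set ps then incidence_oracle \<Delta> r n E (fst p) (snd p) else None) = Some e)
        \<longleftrightarrow> (\<exists>v\<in>{1..n}. \<exists>j\<in>{1..\<Delta>}. incidence_oracle \<Delta> r n E v j = Some e)" .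
      then show "e \<in> {e. \<exists>p. (if p \<in> set ps then incidence_oracle \<Delta> r n E (fst p) (snd p) else None) = Some e}
        \<longleftrightarrow> e \<in> E"
        by (simp only: mem_Collect_eq incidence_oracle_range[OF that k r, of e])
    qed
    then have "accepts (incidence_oracle \<Delta> r n E) (query_all ps (\<lambda>tab. P n {e. \<exists>p. tab p = Some e})) = P n E"
      unfolding accepts_query_all by simp
    then show ?thesis by (simp add: accept_prob_def T_def measure_return_pmf indicator_def)
  qed
  have "\<not> far_from k \<Delta> \<epsilon> P n E" if "bounded_hypergraph k \<Delta> n E" "P n E" for E
    using that \<open>\<epsilon> \<ge> 0\<close>
    by (auto simp: far_from_def bounded_hypergraph_def hypergraph_dist_def intro!: exI[of _ E])
  then have "is_tester k \<Delta> \<epsilon> P r n T" by (auto simp: is_tester_def acc)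
  moreover have "queries_at_most k \<Delta> r n T (length ps)"
    by (simp add: queries_at_most_def T_def num_queries_query_all)
  ultimately show ?thesis by blast
qed

section \<open>Comparing acceptance on the two kinds of lifts\<close>

text \<open>Averaging as in Yao's principle: the sum of acceptance probabilities is the expected
  number of inputs that the random tree accepts, so a comparison for each single tree
  suffices.\<close>

lemma sum_accept_prob_le:
  fixes T :: "query_tree pmf"
  assumes "finite G"
    and "\<And>t. t \<in> set_pmf T \<Longrightarrow> card {g \<in> G. accepts (orc g) t} \<le> card {g \<in> G. accepts (orc' g) t}"
  shows "(\<Sum>g\<in>G. accept_prob (orc g) T) \<le> (\<Sum>g\<in>G. accept_prob (orc' g) T)"
proof -
  have sum: "(\<Sum>g\<in>G. accept_prob (o1 g) T) = measure_pmf.expectation T (\<lambda>t. card {g \<in> G. accepts (o1 g) t})"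
    and int: "integrable (measure_pmf T) (\<lambda>t. real (card {g \<in> G. accepts (o1 g) t}))"
    for o1 :: "'a \<Rightarrow> nat \<Rightarrow> nat \<Rightarrow> nat set option"
  proof -
    have *: "real (card {g \<in> G. accepts (o1 g) t}) = (\<Sum>g\<in>G. indicator {t. accepts (o1 g) t} t)" for t
      using assms(1) by (simp add: indicator_def sum.If_cases Int_def)
    have i: "integrable (measure_pmf T) (\<lambda>t. indicator {t. accepts (o1 g) t} t :: real)" for g
      by (rule measure_pmf.integrable_const_bound[where B = 1]) auto
    show "integrable (measure_pmf T) (\<lambda>t. real (card {g \<in> G. accepts (o1 g) t}))"
      unfolding * by (rule Bochner_Integration.integrable_sum) (rule i)
    show "(\<Sum>g\<in>G. accept_prob (o1 g) T) = measure_pmf.expectation T (\<lambda>t. card {g \<in> G. accepts (o1 g) t})"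
      unfolding * by (subst Bochner_Integration.integral_sum[OF i]) (simp add: accept_prob_def)
  qed
  show ?thesis
    unfolding sum using assms(2) by (intro integral_mono_AE int) (auto simp: AE_measure_pmf_iff)
qed

text \<open>The map \<open>\<phi>\<close> adds to g a correction depending only on the set
  \<open>Q g\<close> of queried vertices. The run on \<open>\<phi> g\<close> queries the same set,
  so the correction can be read off from \<open>\<phi> g\<close> and subtracted; hence
  \<open>\<phi>\<close> is injective on G while acceptance is preserved.\<close>

lemma accepting_labels_le:
  fixes \<Delta> n :: nat and r :: "nat set rel"
  assumes k: "k > 0" and B: "expanding k \<delta> D m B" and q: "real (q * D) \<le> \<delta> * m"
  defines "G \<equiv> {..<m} \<rightarrow>\<^sub>E {0..<int k}"
    and "orc \<equiv> \<lambda>b g. incidence_oracle \<Delta> r n (lift k m B (\<lambda>e. b + (\<Sum>x\<in>e. g x)))"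
  assumes t: "\<And>g. num_queries (orc 1 g) t \<le> q"
  shows "card {g \<in> G. accepts (orc 1 g) t} \<le> card {g \<in> G. accepts (orc 0 g) t}"
proof -
  have Bk: "B \<subseteq> {e. e \<subseteq> {..<m} \<and> card e = k}"
    and deg: "\<And>x. x < m \<Longrightarrow> card {e \<in> B. x \<in> e} \<le> D"
    and uniq: "\<And>F. F \<subseteq> B \<Longrightarrow> F \<noteq> {} \<Longrightarrow> real (card F) \<le> \<delta> * real m \<Longrightarrow>
      \<exists>e\<in>F. \<exists>x\<in>e. \<forall>e'\<in>F. x \<in> e' \<longrightarrow> e' = e"
    using B by (simp_all add: expanding_def)
  have finB: "finite B" using Bk by (rule finite_subset) simp
  have sub: "e \<subseteq> {..<m}" if "e \<in> B" for e using Bk that by blast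
  define touched where "touched Q = {e \<in> B. \<exists>v\<in>Q. base k v \<in> e}" for Q
  define Q where "Q g = queried (orc 1 g) t" for g
  have "\<exists>h. \<forall>e\<in>touched (Q g). (\<Sum>x\<in>e. h x) = (1 :: int)" for g
  proof (rule integer_system_solvable)
    have tB: "touched (Q g) \<subseteq> B" by (auto simp: touched_def)
    then show fin: "finite (touched (Q g))" using finB by (rule finite_subset)
    show "finite e" if "e \<in> touched (Q g)" for e
      using sub[of e] tB that finite_subset[of e "{..<m}"] by auto
    \<comment> \<open>Each queried vertex touches at most D hyperedges of B, so at most
      \<open>q * D\<close> are touched, few enough for unique neighbours in every subfamily.\<close>
    have "touched (Q g) = (\<Union>v\<in>Q g. {e \<in> B. base k v \<in> e})" by (auto simp: touched_def)
    then have "card (touched (Q g)) \<le> (\<Sum>v\<in>Q g. card {e \<in> B. base k v \<in> e})"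
      using card_UN_le[of "Q g" "\<lambda>v. {e \<in> B. base k v \<in> e}"] finite_queried by (simp add: Q_def)
    also have "\<dots> \<le> (\<Sum>v\<in>Q g. D)"
    proof (rule sum_mono)
      fix v
      show "card {e \<in> B. base k v \<in> e} \<le> D"
      proof (cases "base k v < m")
        case False
        then have "{e \<in> B. base k v \<in> e} = {}" using sub by fastforce
        then show ?thesis by (metis card.empty le0)
      qed (rule deg)
    qed
    also have "\<dots> = card (Q g) * D" by simp
    also have "\<dots> \<le> q * D"
      using card_queried_le[of "orc 1 g" t] t[of g] unfolding Q_def by (intro mult_right_mono) auto
    finally have small: "real (card (touched (Q g))) \<le> \<delta> * m"
      using q by (meson of_nat_le_iff order_trans)
    show "\<exists>e\<in>F'. \<exists>x\<in>e. \<forall>e'\<in>F'. x \<in> e' \<longrightarrow> e' = e" if F': "F' \<subseteq> touched (Q g)" "F' \<noteq> {}" for F'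
    proof (rule uniq)
      show "F' \<subseteq> B" using F'(1) tB by (rule order_trans)
      have "card F' \<le> card (touched (Q g))" using fin F'(1) by (rule card_mono)
      then show "real (card F') \<le> \<delta> * m" using small by simp
    qed (rule F'(2))
  qed
  \<comment> \<open>The solution is chosen per queried set rather than per labelling, so that
    labellings with equal queried sets get equal corrections.\<close>
  then have "\<forall>S. \<exists>h. S \<in> range Q \<longrightarrow> (\<forall>e\<in>touched S. (\<Sum>x\<in>e. h x) = (1 :: int))" by blast
  then obtain H where H: "\<And>g e. e \<in> touched (Q g) \<Longrightarrow> (\<Sum>x\<in>e. H (Q g) x) = (1 :: int)" by (metis rangeI)
  define \<phi> where "\<phi> g = (\<lambda>x\<in>{..<m}. (g x + H (Q g) x) mod int k)" for g
  have run: "queried (orc 0 (\<phi> g)) t = Q g \<and> accepts (orc 0 (\<phi> g)) t = accepts (orc 1 g) t" for g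
    unfolding Q_def
  proof (rule same_run)
    fix v j assume v: "v \<in> queried (orc 1 g) t"
    show "orc 1 g v j = orc 0 (\<phi> g) v j"
      unfolding orc_def
    proof (intro incidence_oracle_cong incident_edges_lift_cong)
      fix e assume e: "e \<in> B" "base k v \<in> e"
      then have "e \<in> touched (Q g)" using v by (auto simp: touched_def Q_def)
      \<comment> \<open>On touched hyperedges the correction sums to 1 and absorbs the offset
        between the two kinds of labels.\<close>
      then have "1 + (\<Sum>x\<in>e. g x) = (\<Sum>x\<in>e. g x + H (Q g) x)" by (simp add: sum.distrib H)
      moreover have "[(\<Sum>x\<in>e. g x + H (Q g) x) = (\<Sum>x\<in>e. \<phi> g x)] (mod int k)"
        using sub[OF e(1)] by (intro cong_sum) (auto simp: \<phi>_def cong_def)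
      ultimately show "[1 + (\<Sum>x\<in>e. g x) = 0 + (\<Sum>x\<in>e. \<phi> g x)] (mod int k)" by simp
    qed
  qed
  show ?thesis
  proof (rule card_inj_on_le)
    show "inj_on \<phi> {g \<in> G. accepts (orc 1 g) t}"
    proof (rule inj_onI)
      fix g g' assume g: "g \<in> {g \<in> G. accepts (orc 1 g) t}" "g' \<in> {g \<in> G. accepts (orc 1 g) t}"
        and eq: "\<phi> g = \<phi> g'"
      have Qeq: "Q g = Q g'" using run[of g] run[of g'] eq by simp
      show "g = g'"
      proof (rule PiE_ext)
        show gP: "g \<in> {..<m} \<rightarrow>\<^sub>E {0..<int k}" "g' \<in> {..<m} \<rightarrow>\<^sub>E {0..<int k}"
          using g by (auto simp: G_def)
        fix x assume x: "x \<in> {..<m}"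
        have "(g x + H (Q g) x) mod int k = (g' x + H (Q g) x) mod int k"
          using fun_cong[OF eq, of x] x Qeq by (simp add: \<phi>_def)
        then have "[g x = g' x] (mod int k)" by (simp add: cong_def[symmetric] cong_add_rcancel)
        moreover have "g x \<in> {0..<int k}" "g' x \<in> {0..<int k}" using gP x by (auto simp: PiE_iff)
        ultimately show "g x = g' x" by (simp add: cong_def)
      qed
    qed
    show "\<phi> ` {g \<in> G. accepts (orc 1 g) t} \<subseteq> {g \<in> G. accepts (orc 0 g) t}"
      using k run by (auto simp: G_def \<phi>_def)
    show "finite {g \<in> G. accepts (orc 0 g) t}" by (auto simp: G_def intro!: finite_PiE)
  qed
qed

text \<open>Were \<open>q * D\<close> at most \<open>\<delta> * m\<close>, acceptance summed over G
  would be no larger on the colorable lifts than on the far ones, against the bounds 2/3 and 1/3 for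
  each labelling.\<close>

lemma tester_queries_lower_bound:
  assumes k: "k \<ge> 2" and D: "D > 0" and m: "m > 0" and B: "expanding k \<delta> D m B"
    and n: "k * m \<le> n" "n \<le> 2 * k * m"
  defines "\<Delta> \<equiv> D * 2 ^ (k * k)"
  assumes T: "is_tester k \<Delta> (1 / real (4 * k * \<Delta>)) (colorable k) r n T"
    and q: "queries_at_most k \<Delta> r n T q"
  shows "\<delta> * m < real (q * D)"
proof (rule ccontr)
  assume "\<not> \<delta> * m < real (q * D)"
  then have small: "real (q * D) \<le> \<delta> * m" by simp
  define E where "E b g = lift k m B (\<lambda>e. b + (\<Sum>x\<in>e. g x))" for b :: int and g
  define orc where "orc b g = incidence_oracle \<Delta> r n (E b g)" for b g
  define G where "G = {..<m} \<rightarrow>\<^sub>E {0..<int k}"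
  have finG: "finite G" by (auto simp: G_def intro!: finite_PiE)
  have "G \<noteq> {}" using k by (auto simp: G_def PiE_eq_empty_iff)
  have Bk: "B \<subseteq> {e. e \<subseteq> {..<m} \<and> card e = k}" and deg: "\<And>x. x < m \<Longrightarrow> card {e \<in> B. x \<in> e} \<le> D"
    using B by (simp_all add: expanding_def)
  have bounded: "bounded_hypergraph k \<Delta> n (E b g)" for b g
    unfolding E_def \<Delta>_def using k by (intro bounded_hypergraph_lift Bk deg n(1)) auto
  have yes: "2 / 3 \<le> accept_prob (orc 1 g) T" for g
    using T bounded[of 1 g] colorable_lift[OF k Bk] by (simp add: is_tester_def orc_def E_def)
  have no: "accept_prob (orc 0 g) T \<le> 1 / 3" if "g \<in> G" for g
  proof -
    have "far_from k \<Delta> (1 / real (4 * k * \<Delta>)) (colorable k) n (E 0 g)"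
      unfolding E_def add_0
    proof (rule far_from_lift[OF _ _ B m n])
      show "g x \<in> {0..<int k}" if "x < m" for x using \<open>g \<in> G\<close> that by (auto simp: G_def PiE_iff)
    qed (use k D in \<open>auto simp: \<Delta>_def\<close>)
    then show ?thesis using T bounded[of 0 g] by (simp add: is_tester_def orc_def)
  qed
  have "(\<Sum>g\<in>G. accept_prob (orc 1 g) T) \<le> (\<Sum>g\<in>G. accept_prob (orc 0 g) T)"
  proof (rule sum_accept_prob_le[OF finG])
    fix t assume "t \<in> set_pmf T"
    then have "num_queries (orc 1 g) t \<le> q" for g
      using q bounded[of 1 g] by (auto simp: queries_at_most_def orc_def)
    then show "card {g \<in> G. accepts (orc 1 g) t} \<le> card {g \<in> G. accepts (orc 0 g) t}"
      unfolding orc_def E_def G_def using k by (intro accepting_labels_le[OF _ B small]) auto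
  qed
  moreover have "(\<Sum>g\<in>G. 2 / 3) \<le> (\<Sum>g\<in>G. accept_prob (orc 1 g) T)" by (intro sum_mono yes)
  moreover have "(\<Sum>g\<in>G. accept_prob (orc 0 g) T) \<le> (\<Sum>g\<in>G. 1 / 3)" by (intro sum_mono no)
  ultimately have "real (card G) * (2 / 3) \<le> real (card G) * (1 / 3)" by simp
  moreover have "card G > 0" using finG \<open>G \<noteq> {}\<close> by (simp add: card_gt_0_iff)
  ultimately show False by simp
qed

theorem theorem1:
  fixes k :: nat
  assumes "k \<ge> 3"
  shows "\<exists>(d_col :: nat) (\<epsilon>_col :: real). d_col > 0 \<and> \<epsilon>_col > 0 \<and>
    (\<forall>r :: nat \<Rightarrow> nat set rel. (\<forall>n. linear_order_on (all_edges k n) (r n)) \<longrightarrow>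
      (\<lambda>n. real (testing_query_complexity k d_col \<epsilon>_col (colorable k) r n)) \<in> \<Omega>(\<lambda>n. real n))"
proof -
  obtain \<delta> :: real and D M where \<delta>: "\<delta> > 0" and D: "D > 0"
    and ex: "\<And>m. m \<ge> M \<Longrightarrow> \<exists>B. expanding k \<delta> D m B"
    using expanding_exists[OF assms] by blast
  define \<Delta> where "\<Delta> = D * 2 ^ (k * k)"
  define \<epsilon> where "\<epsilon> = 1 / real (4 * k * \<Delta>)"
  have \<Delta>: "\<Delta> > 0" using D by (simp add: \<Delta>_def)
  have \<epsilon>: "\<epsilon> > 0" using \<Delta> assms by (simp add: \<epsilon>_def)
  have "(\<lambda>n. real (testing_query_complexity k \<Delta> \<epsilon> (colorable k) r n)) \<in> \<Omega>(\<lambda>n. real n)"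
    if r: "\<forall>n. linear_order_on (all_edges k n) (r n)" for r
  proof (rule landau_omega.bigI)
    show "\<forall>\<^sub>F n in sequentially. \<delta> / (2 * k * D) * norm (real n)
        \<le> norm (real (testing_query_complexity k \<Delta> \<epsilon> (colorable k) r n))"
    proof (rule eventually_sequentiallyI)
      fix n assume n: "n \<ge> k * (M + 1)"
      \<comment> \<open>The fewer than k vertices beyond \<open>k * m\<close> stay isolated. The
        bound on n gives m \<ge> M and m \<ge> 1, whence \<open>n \<le> 2 * k * m\<close>.\<close>
      define m where "m = n div k"
      have "k * (M + 1) div k \<le> m" unfolding m_def using n by (rule div_le_mono)
      then have mM: "m \<ge> M" "m > 0" using assms by auto
      then obtain B where B: "expanding k \<delta> D m B" using ex by blast
      have n1: "k * m \<le> n" by (simp add: m_def)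
      have "n = k * m + n mod k" "n mod k < k" using assms by (simp_all add: m_def)
      moreover have "k \<le> k * m" using mM by simp
      ultimately have n2: "n \<le> 2 * k * m" by linarith
      let ?S = "{q. \<exists>T. is_tester k \<Delta> \<epsilon> (colorable k) (r n) n T \<and> queries_at_most k \<Delta> (r n) n T q}"
      have "?S \<noteq> {}"
        using tester_exists[of k n "r n" \<epsilon> \<Delta> "colorable k"] r assms \<epsilon> by auto
      define q where "q = testing_query_complexity k \<Delta> \<epsilon> (colorable k) r n"
      \<comment> \<open>An infimum of a nonempty set of naturals is attained, so q bounds the
        queries of an actual tester.\<close>
      have "q \<in> ?S"
        unfolding q_def testing_query_complexity_def by (rule Inf_nat_def1) fact
      then obtain T where T: "is_tester k \<Delta> \<epsilon> (colorable k) (r n) n T"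
        "queries_at_most k \<Delta> (r n) n T q" by blast
      have "\<delta> * m \<le> real (q * D)"
        using tester_queries_lower_bound[OF _ D mM(2) B n1 n2 T[unfolded \<epsilon>_def \<Delta>_def]] assms by simp
      then have "2 * real k * (\<delta> * m) \<le> 2 * real k * (q * D)" by (intro mult_left_mono) auto
      moreover have "\<delta> * n \<le> \<delta> * (2 * real k * m)"
      proof (rule mult_left_mono)
        show "real n \<le> 2 * real k * real m" using of_nat_mono[OF n2, where ?'a = real] by simp
      qed (use \<delta> in simp)
      ultimately have "\<delta> * n \<le> q * (2 * k * D)" by (simp add: mult_ac)
      then have "\<delta> * n / (2 * k * D) \<le> q"
        using D assms by (simp add: pos_divide_le_eq)
      then show "\<delta> / (2 * k * D) * norm (real n)
        \<le> norm (real (testing_query_complexity k \<Delta> \<epsilon> (colorable k) r n))"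
        by (simp add: q_def)
    qed
    show "\<delta> / (2 * k * D) > 0" using \<delta> D assms by simp
  qed
  then show ?thesis using \<Delta> \<epsilon> by blast
qed

end
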